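(* Let $(R,\mathfrak m,k)$ be a noetherian local ring. Let $\mathfrak q\subseteq\mathfrak m$ be an ideal such that $\mathfrak m^2=\mathfrak q\mathfrak m$ and $\mathfrak q^2=0$. Let $y_1,\ldots,y_e$ be a minimal generating set of $\mathfrak q$, where $y_i\in\mathfrak m$. Then the collection of ideals $$\mathcal F=\{0,(y_1),(y_1,y_2),\ldots,(y_1,\ldots,y_{e-1})\}\ \cup\ \{I\subseteq\mathfrak m : I \text{ an ideal containing } \mathfrak q\}$$ is a Koszul filtration for $R$. Moreover, any non-zero finitely generated $R$-module $M$ that satisfies $\mathfrak qM=0$ is a Koszul module.
   Context: Rings are commutative noetherian. Koszul filtration: let $(R,\mathfrak m,k)$ be a local ring and $\mathcal F$ a collection of ideals of $R$. $\mathcal F$ is a Koszul filtration of $R$ if all of the following hold: (F1) $(0),\mathfrak m\in\mathcal F$; (F2) for every $I\in\mathcal F$ and all $s\ge 1$, $I\cap\mathfrak m^{s+1}=\mathfrak m^sI$; (F3) for every ideal $I\ne(0)$ of $\mathcal F$ there exist a finite filtration $(0)=I_0\subset I_1\subset\cdots\subset I_n=I$ and elements $x_j\in\mathfrak m$ such that for each $j=1,\dots,n$: $I_j\in\mathcal F$, $I_j=I_{j-1}+(x_j)$ and $I_{j-1}:x_j\in\mathcal F$. Linearity defect: for a finitely generated $R$-module $M$ with minimal free resolution $F$, filter $F$ by the subcomplexes $\mathcal G^nF$ with $(\mathcal G^nF)_i=\mathfrak m^{n-i}F_i$ (where $\mathfrak m^j=R$ for $j\le 0$), with differential induced by that of $F$.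 The associated graded complex of this filtration is the linear part $\operatorname{lin}^R F$. The linearity defect is $\operatorname{ld}_R M=\sup\{i: H_i(\operatorname{lin}^R F)\ne 0\}\in\{0,1,\dots\}\cup\{\infty\}$ for $M\neq 0$, and $\operatorname{ld}_R 0=0$. $M$ is a Koszul module if $\operatorname{ld}_R M=0$. *)

theory Defs
  imports "HOL-Algebra.Algebra" "HOL-Library.Extended_Nat"
begin

section \<open>Local rings and ideals\<close>

definition noetherian_local_ring :: "('a, 'r) ring_scheme \<Rightarrow> 'a set \<Rightarrow> bool" where
  "noetherian_local_ring R \<mm> \<longleftrightarrow>
     cring R \<and> noetherian_ring R \<and> maximalideal \<mm> R \<and> (\<forall>J. maximalideal J R \<longrightarrow> J = \<mm>)"

abbreviation ideal_power :: "('a, 'r) ring_scheme \<Rightarrow> 'a set \<Rightarrow> nat \<Rightarrow> 'a set" where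
  "ideal_power R I n \<equiv> I [^]\<^bsub>ideals_set R\<^esub> n"

definition ideal_colon :: "('a, 'r) ring_scheme \<Rightarrow> 'a set \<Rightarrow> 'a \<Rightarrow> 'a set" where
  "ideal_colon R I x = {r \<in> carrier R. r \<otimes>\<^bsub>R\<^esub> x \<in> I}"

definition minimal_generating_set :: "('a, 'r) ring_scheme \<Rightarrow> 'a set \<Rightarrow> 'a set \<Rightarrow> bool" where
  "minimal_generating_set R I Y \<longleftrightarrow>
     Y \<subseteq> carrier R \<and> Idl\<^bsub>R\<^esub> Y = I \<and> (\<forall>Z. Z \<subset> Y \<longrightarrow> Idl\<^bsub>R\<^esub> Z \<noteq> I)"

section \<open>Koszul filtrations\<close>

definition koszul_filtration ::
    "('a, 'r) ring_scheme \<Rightarrow> 'a set \<Rightarrow> 'a set set \<Rightarrow> bool" where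
  "koszul_filtration R \<mm> \<F> \<longleftrightarrow>
     (\<forall>I\<in>\<F>. ideal I R) \<and>
     {\<zero>\<^bsub>R\<^esub>} \<in> \<F> \<and> \<mm> \<in> \<F> \<and>
     (\<forall>I\<in>\<F>. \<forall>s\<ge>1. I \<inter> ideal_power R \<mm> (s + 1) = ideal_power R \<mm> s \<cdot>\<^bsub>R\<^esub> I) \<and>
     (\<forall>I\<in>\<F>. I \<noteq> {\<zero>\<^bsub>R\<^esub>} \<longrightarrow>
        (\<exists>(n::nat) J x. J 0 = {\<zero>\<^bsub>R\<^esub>} \<and> J n = I \<and>
           (\<forall>j\<in>{1..n}. x j \<in> \<mm> \<and> J (j - 1) \<subset> J j \<and> J j \<in> \<F> \<and>
              J j = J (j - 1) <+>\<^bsub>R\<^esub> PIdl\<^bsub>R\<^esub> (x j) \<and>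
              ideal_colon R (J (j - 1)) (x j) \<in> \<F>)))"

section \<open>Modules\<close>

definition generated_submodule ::
    "('a, 'r) ring_scheme \<Rightarrow> ('a, 'b, 'm) module_scheme \<Rightarrow> 'b set \<Rightarrow> 'b set" where
  "generated_submodule R M S = \<Inter>{N. submodule N R M \<and> S \<subseteq> N}"

definition finitely_generated_module ::
    "('a, 'r) ring_scheme \<Rightarrow> ('a, 'b, 'm) module_scheme \<Rightarrow> bool" where
  "finitely_generated_module R M \<longleftrightarrow>
     module R M \<and> (\<exists>S. finite S \<and> S \<subseteq> carrier M \<and> generated_submodule R M S = carrier M)"

definition ideal_times_module ::
    "('a, 'r) ring_scheme \<Rightarrow> 'a set \<Rightarrow> ('a, 'b, 'm) module_scheme \<Rightarrow> 'b set" where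
  "ideal_times_module R I M =
     generated_submodule R M {a \<odot>\<^bsub>M\<^esub> x | a x. a \<in> I \<and> x \<in> carrier M}"

definition linear_maps ::
    "('a, 'r) ring_scheme \<Rightarrow> ('a, 'b, 'm) module_scheme \<Rightarrow> ('a, 'c, 'n) module_scheme
       \<Rightarrow> ('b \<Rightarrow> 'c) set" where
  "linear_maps R M N =
     {f \<in> hom (add_monoid M) (add_monoid N).
        \<forall>a\<in>carrier R. \<forall>x\<in>carrier M. f (a \<odot>\<^bsub>M\<^esub> x) = a \<odot>\<^bsub>N\<^esub> f x}"

text \<open>The free module of rank \<open>b\<close>. The ring multiplication and unit that the module record
  inherits from the ring record play no role.\<close>

definition free_module :: "('a, 'r) ring_scheme \<Rightarrow> nat \<Rightarrow> ('a, nat \<Rightarrow> 'a) module" where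
  "free_module R b =
     \<lparr>carrier = {..<b} \<rightarrow>\<^sub>E carrier R,
      monoid.mult = undefined,
      one = undefined,
      ring.zero = (\<lambda>i\<in>{..<b}. \<zero>\<^bsub>R\<^esub>),
      ring.add = (\<lambda>u v. \<lambda>i\<in>{..<b}. u i \<oplus>\<^bsub>R\<^esub> v i),
      smult = (\<lambda>a v. \<lambda>i\<in>{..<b}. a \<otimes>\<^bsub>R\<^esub> v i)\<rparr>"

section \<open>Minimal free resolutions and the linear part\<close>

text \<open>A complex is given by modules \<open>F i\<close> (\<open>i \<ge> 0\<close>) with differentials
  \<open>d i : F (i + 1) \<rightarrow> F i\<close>; the differential out of \<open>F 0\<close> is zero. Finitely generated free
  modules are taken in the form \<open>R\<^sup>b\<close>, which is no restriction up to isomorphism.\<close>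

definition minimal_free_resolution ::
    "('a, 'r) ring_scheme \<Rightarrow> 'a set \<Rightarrow> ('a, 'b, 'm) module_scheme
       \<Rightarrow> (nat \<Rightarrow> ('a, nat \<Rightarrow> 'a) module)
       \<Rightarrow> (nat \<Rightarrow> (nat \<Rightarrow> 'a) \<Rightarrow> (nat \<Rightarrow> 'a))
       \<Rightarrow> ((nat \<Rightarrow> 'a) \<Rightarrow> 'b) \<Rightarrow> bool" where
  "minimal_free_resolution R \<mm> M F d \<epsilon> \<longleftrightarrow>
     (\<forall>i. \<exists>b. F i = free_module R b) \<and>
     (\<forall>i. d i \<in> linear_maps R (F (Suc i)) (F i)) \<and>
     \<epsilon> \<in> linear_maps R (F 0) M \<and>
     \<epsilon> ` carrier (F 0) = carrier M \<and>
     d 0 ` carrier (F 1) = a_kernel (F 0) M \<epsilon> \<and>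
     (\<forall>i. d (Suc i) ` carrier (F (Suc (Suc i))) = a_kernel (F (Suc i)) (F i) (d i)) \<and>
     (\<forall>i. d i ` carrier (F (Suc i)) \<subseteq> ideal_times_module R \<mm> (F i))"

text \<open>\<open>adic_filtration R \<mm> F n i\<close> is \<open>(\<G>\<^sup>n F)\<^sub>i = \<mm>\<^sup>n\<^sup>-\<^sup>i F\<^sub>i\<close>. Truncated subtraction realises the
  convention that \<open>\<mm>\<^sup>j = R\<close> for \<open>j \<le> 0\<close>. Negative \<open>n\<close> are omitted, since
  \<open>\<G>\<^sup>n F = F\<close> for all \<open>n \<le> 0\<close>.\<close>

definition adic_filtration ::
    "('a, 'r) ring_scheme \<Rightarrow> 'a set \<Rightarrow> (nat \<Rightarrow> ('a, 'b) module) \<Rightarrow> nat \<Rightarrow> nat \<Rightarrow> 'b set" where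
  "adic_filtration R \<mm> F n i = ideal_times_module R (ideal_power R \<mm> (n - i)) (F i)"

definition graded_piece ::
    "('a, 'r) ring_scheme \<Rightarrow> 'a set \<Rightarrow> (nat \<Rightarrow> ('a, 'b) module) \<Rightarrow> nat \<Rightarrow> nat
       \<Rightarrow> 'b set monoid" where
  "graded_piece R \<mm> F n i =
     (add_monoid (F i))\<lparr>carrier := adic_filtration R \<mm> F n i\<rparr> Mod adic_filtration R \<mm> F (Suc n) i"

text \<open>The associated graded complex of the filtration, as a complex of abelian groups written
  multiplicatively. In homological degree \<open>i\<close> it is the direct sum over \<open>n\<close> of the quotients
  \<open>(\<G>\<^sup>n F)\<^sub>i / (\<G>\<^sup>n\<^sup>+\<^sup>1 F)\<^sub>i\<close>, and \<open>linear_part_diff R \<mm> F d i\<close> is the induced map from degree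
  \<open>i + 1\<close> to degree \<open>i\<close>, which sends the class of \<open>v\<close> to the class of \<open>d i v\<close> in each
  component.\<close>

definition linear_part ::
    "('a, 'r) ring_scheme \<Rightarrow> 'a set \<Rightarrow> (nat \<Rightarrow> ('a, 'b) module) \<Rightarrow> nat
       \<Rightarrow> (nat \<Rightarrow> 'b set) monoid" where
  "linear_part R \<mm> F i = sum_group UNIV (\<lambda>n. graded_piece R \<mm> F n i)"

definition linear_part_diff ::
    "('a, 'r) ring_scheme \<Rightarrow> 'a set \<Rightarrow> (nat \<Rightarrow> ('a, 'b) module) \<Rightarrow> (nat \<Rightarrow> 'b \<Rightarrow> 'b) \<Rightarrow> nat
       \<Rightarrow> (nat \<Rightarrow> 'b set) \<Rightarrow> (nat \<Rightarrow> 'b set)" where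
  "linear_part_diff R \<mm> F d i x =
     (\<lambda>n. \<Union>v\<in>x n. adic_filtration R \<mm> F (Suc n) i +>\<^bsub>F i\<^esub> d i v)"

definition linear_part_cycles ::
    "('a, 'r) ring_scheme \<Rightarrow> 'a set \<Rightarrow> (nat \<Rightarrow> ('a, 'b) module) \<Rightarrow> (nat \<Rightarrow> 'b \<Rightarrow> 'b) \<Rightarrow> nat
       \<Rightarrow> (nat \<Rightarrow> 'b set) set" where
  "linear_part_cycles R \<mm> F d i =
     (case i of
        0 \<Rightarrow> carrier (linear_part R \<mm> F 0)
      | Suc j \<Rightarrow> kernel (linear_part R \<mm> F (Suc j)) (linear_part R \<mm> F j)
                   (linear_part_diff R \<mm> F d j))"

definition linear_part_homology ::
    "('a, 'r) ring_scheme \<Rightarrow> 'a set \<Rightarrow> (nat \<Rightarrow> ('a, 'b) module) \<Rightarrow> (nat \<Rightarrow> 'b \<Rightarrow> 'b) \<Rightarrow> nat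
       \<Rightarrow> (nat \<Rightarrow> 'b set) set monoid" where
  "linear_part_homology R \<mm> F d i =
     (linear_part R \<mm> F i)\<lparr>carrier := linear_part_cycles R \<mm> F d i\<rparr> Mod
       (linear_part_diff R \<mm> F d i ` carrier (linear_part R \<mm> F (Suc i)))"

section \<open>Linearity defect and Koszul modules\<close>

text \<open>A minimal free resolution is unique up to isomorphism of complexes, so any choice of one
  computes the linearity defect.\<close>

definition linearity_defect ::
    "('a, 'r) ring_scheme \<Rightarrow> 'a set \<Rightarrow> ('a, 'b, 'm) module_scheme \<Rightarrow> enat" where
  "linearity_defect R \<mm> M =
     (if carrier M = {\<zero>\<^bsub>M\<^esub>} then 0
      else let (F, d) = (SOME (F, d). \<exists>\<epsilon>. minimal_free_resolution R \<mm> M F d \<epsilon>)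
           in SUP i \<in> {i. \<not> trivial_group (linear_part_homology R \<mm> F d i)}. enat i)"

definition koszul_module ::
    "('a, 'r) ring_scheme \<Rightarrow> 'a set \<Rightarrow> ('a, 'b, 'm) module_scheme \<Rightarrow> bool" where
  "koszul_module R \<mm> M \<longleftrightarrow> finitely_generated_module R M \<and> linearity_defect R \<mm> M = 0"

end

theory Submission
  imports Defs
begin

text \<open>Everything rests on \<open>\<mm>\<^sup>3 = \<qq>\<mm>\<^sup>2 = \<qq>\<^sup>2\<mm> = 0\<close>.

  For the Koszul filtration, condition (F2) is only in question for \<open>s = 1\<close>. If \<open>I\<close> contains \<open>\<qq>\<close>,
  it holds because \<open>\<mm>\<^sup>2 = \<qq>\<mm>\<close>. If \<open>I\<close> is generated by part of the minimal generating set of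
  \<open>\<qq>\<close>, it holds because a combination of minimal generators that lies in \<open>\<qq>\<mm>\<close> has all its
  coefficients in \<open>\<mm>\<close> (\<open>initial_ideal_inter_max_square\<close>). For (F3) one adds the \<open>y\<^sub>j\<close> one after
  the other, and then further generators. In the first phase a colon ideal contains \<open>\<qq>\<close>, as
  \<open>\<qq>\<^sup>2 = 0\<close>; in the second phase it equals \<open>\<mm>\<close>, as \<open>\<mm>\<^sup>2 \<subseteq> \<qq>\<close>.

  For the modules, let \<open>F\<close> be a minimal free resolution of \<open>M\<close>. Since \<open>\<mm>\<^sup>3 = 0\<close> and \<open>F\<close> is exact, the
  linear part of \<open>F\<close> is exact in positive degrees as soon as \<open>\<mm>\<^sup>2 F\<^sub>i \<subseteq> d(\<mm> F\<^sub>i\<^sub>+\<^sub>1)\<close> for all \<open>i\<close>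
  (\<open>graded_exact\<close>). In degree zero this is clear: \<open>\<qq>M = 0\<close> means \<open>\<qq>F\<^sub>0 \<subseteq> d(F\<^sub>1)\<close>, so
  \<open>\<mm>\<^sup>2 F\<^sub>0 = \<mm>\<qq>F\<^sub>0 \<subseteq> d(\<mm> F\<^sub>1)\<close>. Higher syzygies of \<open>M\<close> need not be killed by \<open>\<qq>\<close>, but they admit a
  finite filtration along which \<open>\<qq>\<close> acts by zero up to boundaries and up to \<open>\<mm>\<close> times the
  preceding step. Such a filtration of \<open>F\<^sub>i\<close> (\<open>descent\<close>) yields the inclusion in degree \<open>i\<close>
  (\<open>m2_descent_lifts\<close>), and it induces a filtration of the same kind of \<open>F\<^sub>i\<^sub>+\<^sub>1\<close>, with one more
  step (\<open>q_descent\<close>).\<close>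

section \<open>Products, colons and generation of ideals\<close>

lemma ideals_set_ops [simp]:
  "one (ideals_set R) = carrier R" "monoid.mult (ideals_set R) = ideal_prod R"
  by (simp_all add: ideals_set_def)

lemma ideal_prod_mono: "I \<subseteq> I' \<Longrightarrow> J \<subseteq> J' \<Longrightarrow> I \<cdot>\<^bsub>R\<^esub> J \<subseteq> I' \<cdot>\<^bsub>R\<^esub> J'"
proof
  fix a assume "I \<subseteq> I'" "J \<subseteq> J'" "a \<in> I \<cdot>\<^bsub>R\<^esub> J"
  from this(3) this(1,2) show "a \<in> I' \<cdot>\<^bsub>R\<^esub> J'"
    by induct (auto intro: ideal_prod.intros)
qed

context cring
begin

lemma cring_idealI:
  assumes "I \<subseteq> carrier R" "\<zero> \<in> I" "\<And>a b. a \<in> I \<Longrightarrow> b \<in> I \<Longrightarrow> a \<oplus> b \<in> I"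
    and smult: "\<And>r a. r \<in> carrier R \<Longrightarrow> a \<in> I \<Longrightarrow> r \<otimes> a \<in> I"
  shows "ideal I R"
proof (rule idealI)
  show "ring R" by (rule ring_axioms)
  show "subgroup I (add_monoid R)"
  proof (rule add.subgroupI)
    show "\<ominus> a \<in> I" if "a \<in> I" for a
      using smult[of "\<ominus> \<one>" a] that assms(1) by (auto simp: l_minus)
  qed (use assms in auto)
  show "r \<otimes> a \<in> I" "a \<otimes> r \<in> I" if "a \<in> I" "r \<in> carrier R" for a r
    using smult[of r a] that assms(1) m_comm[of a r] by auto
qed

lemma ideal_power_ideal: "ideal I R \<Longrightarrow> ideal (ideal_power R I n) R"
  by (induct n) (simp_all add: oneideal ideal_prod_is_ideal)

lemma ideal_prod_subsetI:
  assumes "ideal K R" "\<And>i j. i \<in> I \<Longrightarrow> j \<in> J \<Longrightarrow> i \<otimes> j \<in> K"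
  shows "I \<cdot> J \<subseteq> K"
proof
  fix a assume "a \<in> I \<cdot> J"
  thus "a \<in> K"
    by induct (use assms in \<open>auto intro: additive_subgroup.a_closed ideal.axioms\<close>)
qed

lemma ideal_colon_ideal:
  assumes "ideal I R" "x \<in> carrier R"
  shows "ideal (ideal_colon R I x) R"
proof -
  interpret I: ideal I R by fact
  show ?thesis
    unfolding ideal_colon_def
    by (rule cring_idealI) (use assms(2) in \<open>auto simp: l_distr m_assoc I.I_l_closed\<close>)
qed

lemma ideal_multipliers:
  assumes "ideal I R" "S \<subseteq> carrier R"
  shows "ideal {r \<in> carrier R. \<forall>s\<in>S. s \<otimes> r \<in> I} R"
proof -
  interpret I: ideal I R by fact
  show ?thesis
  proof (rule cring_idealI)
    fix r a assume ra: "r \<in> carrier R" "a \<in> {r \<in> carrier R. \<forall>s\<in>S. s \<otimes> r \<in> I}"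
    { fix s assume s: "s \<in> S"
      hence "s \<otimes> (r \<otimes> a) = r \<otimes> (s \<otimes> a)"
        using ra assms(2) by (intro m_lcomm) auto
      hence "s \<otimes> (r \<otimes> a) \<in> I"
        using ra s I.I_l_closed by auto }
    thus "r \<otimes> a \<in> {r \<in> carrier R. \<forall>s\<in>S. s \<otimes> r \<in> I}"
      using ra by auto
  qed (use assms(2) in \<open>auto simp: r_distr subset_iff\<close>)
qed

lemma genideal_insert:
  assumes "Y \<subseteq> carrier R" "y \<in> carrier R"
  shows "Idl (insert y Y) = Idl Y <+> PIdl y"
proof -
  note I = genideal_ideal[OF assms(1)] cgenideal_ideal[OF assms(2)]
  have "Idl (insert y Y) = Idl (Idl Y \<union> PIdl y)"
  proof (rule equalityI)
    show "Idl (insert y Y) \<subseteq> Idl (Idl Y \<union> PIdl y)"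
      using assms genideal_self[OF assms(1)] cgenideal_self[OF assms(2)]
      by (intro subset_Idl_subset) (use I in \<open>auto dest: ideal.Icarr\<close>)
    have c: "insert y Y \<subseteq> carrier R" using assms by auto
    have "Idl Y \<subseteq> Idl (insert y Y)" using c by (intro subset_Idl_subset) auto
    moreover have "PIdl y \<subseteq> Idl (insert y Y)"
      using c genideal_ideal[OF c] genideal_self[OF c] by (intro cgenideal_minimal) auto
    ultimately show "Idl (Idl Y \<union> PIdl y) \<subseteq> Idl (insert y Y)"
      using genideal_ideal[OF c] by (intro genideal_minimal) auto
  qed
  thus ?thesis using union_genideal[OF I] by simp
qed

lemma genideal_empty: "Idl {} = {\<zero>}"
proof
  show "Idl {} \<subseteq> {\<zero>}" by (rule genideal_minimal[OF zeroideal]) simp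
  show "{\<zero>} \<subseteq> Idl {}"
    using genideal_ideal[of "{}"] by (simp add: additive_subgroup.zero_closed ideal.axioms(1))
qed

end

section \<open>Noetherian local rings\<close>

locale noeth_local_ring = cring R + noetherian_ring R for R (structure) +
  fixes \<mm> :: "'a set"
  assumes maximal: "maximalideal \<mm> R"
    and maximal_unique: "maximalideal J R \<Longrightarrow> J = \<mm>"
begin

sublocale max: ideal \<mm> R
  using maximal by (simp add: maximalideal_def)

text \<open>Zorn's lemma gives a maximal ideal above \<open>I\<close>; noetherianity makes unions of chains of ideals
  members of the chain, so that properness passes to them. By uniqueness the maximal ideal is
  \<open>\<mm>\<close>.\<close>

lemma proper_ideal_subset_max:
  assumes "ideal I R" "\<one> \<notin> I"
  shows "I \<subseteq> \<mm>"
proof -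
  let ?A = "{J. ideal J R \<and> I \<subseteq> J \<and> \<one> \<notin> J}"
  have "\<exists>M\<in>?A. \<forall>u\<in>?A. M \<subseteq> u \<longrightarrow> u = M"
  proof (rule subset_Zorn_nonempty)
    show "?A \<noteq> {}" using assms by blast
    fix C assume C: "C \<noteq> {}" "subset.chain ?A C"
    hence "subset.chain {I. ideal I R} C"
      by (auto simp: pred_on.chain_def)
    from ideal_chain_is_trivial[OF C(1) this] C show "\<Union>C \<in> ?A"
      by (auto simp: pred_on.chain_def)
  qed
  then obtain M where M: "ideal M R" "I \<subseteq> M" "\<one> \<notin> M"
    and M_max: "\<And>u. ideal u R \<Longrightarrow> \<one> \<notin> u \<Longrightarrow> M \<subseteq> u \<Longrightarrow> u = M"
    by (metis (mono_tags, lifting) mem_Collect_eq order_trans)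
  have "maximalideal M R"
  proof (rule maximalidealI)
    show "J = M \<or> J = carrier R" if "ideal J R" "M \<subseteq> J" "J \<subseteq> carrier R" for J
      using M_max[OF that(1) _ that(2)] ideal.one_imp_carrier[OF that(1)] by blast
  qed (use M in auto)
  with maximal_unique M(2) show ?thesis by blast
qed

lemma unit_if_notin_max:
  assumes "a \<in> carrier R" "a \<notin> \<mm>"
  shows "a \<in> Units R"
proof -
  have "\<one> \<in> PIdl a"
    using proper_ideal_subset_max[OF cgenideal_ideal[OF assms(1)]] cgenideal_self assms by blast
  then obtain b where b: "b \<in> carrier R" "b \<otimes> a = \<one>"
    by (auto simp: cgenideal_def)
  moreover from this have "a \<otimes> b = \<one>" using assms m_comm by simp
  ultimately show ?thesis
    using assms(1) by (auto simp: Units_def)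
qed

lemma ideal_cancel_unit:
  assumes "ideal I R" "a \<in> carrier R" "a \<notin> \<mm>" "x \<in> carrier R" "a \<otimes> x \<in> I"
  shows "x \<in> I"
proof -
  have u: "a \<in> Units R" using unit_if_notin_max assms by blast
  have "inv a \<otimes> (a \<otimes> x) \<in> I"
    using ideal.I_l_closed[OF assms(1,5)] u by simp
  moreover have "inv a \<otimes> (a \<otimes> x) = x"
    using u assms(4) by (subst m_assoc[symmetric]) auto
  ultimately show ?thesis by simp
qed

end

section \<open>Ideals of square zero that compute the square of the maximal ideal\<close>

text \<open>When \<open>\<qq>\<close> is principal and non-zero, a generator is known as a Conca generator of \<open>\<mm>\<close>;
  the locale is named after this case.\<close>

locale conca_ideal = noeth_local_ring R \<mm> for R (structure) and \<mm> +
  fixes \<qq> :: "'a set"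
  assumes q_ideal: "ideal \<qq> R"
    and q_sub: "\<qq> \<subseteq> \<mm>"
    and max_square: "\<mm> \<cdot> \<mm> = \<qq> \<cdot> \<mm>"
    and q_square: "\<qq> \<cdot> \<qq> = {\<zero>}"
begin

sublocale q: ideal \<qq> R by (rule q_ideal)

lemma q_mult_q: "a \<in> \<qq> \<Longrightarrow> b \<in> \<qq> \<Longrightarrow> a \<otimes> b = \<zero>"
  using ideal_prod.prod[of a \<qq> b \<qq> R] q_square by simp

lemma max_square_sub: "\<qq> \<cdot> \<mm> \<subseteq> \<qq>"
  using ideal_prod_inter[OF q_ideal max.is_ideal] by blast

lemma max_mult_max: "a \<in> \<mm> \<Longrightarrow> b \<in> \<mm> \<Longrightarrow> a \<otimes> b \<in> \<qq>"
  using ideal_prod.prod[of a \<mm> b \<mm> R] max_square max_square_sub by auto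

text \<open>\<open>\<mm>\<^sup>3 = \<qq>\<mm>\<^sup>2 = \<qq>\<^sup>2\<mm> = 0\<close>: only the first two powers of \<open>\<mm>\<close> ever matter below.\<close>

lemma max_cube: "(\<mm> \<cdot> \<mm>) \<cdot> \<mm> = {\<zero>}"
proof -
  have "(\<mm> \<cdot> \<mm>) \<cdot> \<mm> = \<qq> \<cdot> (\<mm> \<cdot> \<mm>)"
    by (simp add: max_square ideal_prod_assoc q_ideal max.is_ideal)
  also have "\<dots> = (\<qq> \<cdot> \<qq>) \<cdot> \<mm>"
    by (simp add: max_square ideal_prod_assoc q_ideal max.is_ideal)
  also have "\<dots> = {\<zero>}"
    using ideal_prod_zero[OF max.is_ideal] ideal_prod_commute[OF zeroideal max.is_ideal]
    by (simp add: q_square)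
  finally show ?thesis .
qed

lemma max_power_zero:
  assumes "3 \<le> n" shows "ideal_power R \<mm> n = {\<zero>}"
  using assms
proof (induct n rule: dec_induct)
  case base
  have "ideal_power R \<mm> 3 = ((carrier R \<cdot> \<mm>) \<cdot> \<mm>) \<cdot> \<mm>"
    by (simp add: numeral_3_eq_3)
  thus ?case
    using ideal_prod_one[OF max.is_ideal] ideal_prod_commute[OF oneideal max.is_ideal] max_cube
    by simp
next
  case (step n)
  thus ?case
    using ideal_prod_zero[OF max.is_ideal] ideal_prod_commute[OF zeroideal max.is_ideal]
    by simp
qed

lemma max_power_1: "ideal_power R \<mm> (Suc 0) = \<mm>"
  using ideal_prod_one[OF max.is_ideal] ideal_prod_commute[OF oneideal max.is_ideal]
  by simp

lemma max_power_2: "ideal_power R \<mm> 2 = \<qq> \<cdot> \<mm>"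
  using max_power_1 by (simp add: numeral_2_eq_2 max_square)

end

section \<open>The Koszul filtration\<close>

text \<open>Condition (F3) for a single ideal, isolated so that chains can be extended step by step.\<close>

definition has_koszul_chain ::
    "('a, 'r) ring_scheme \<Rightarrow> 'a set \<Rightarrow> 'a set set \<Rightarrow> 'a set \<Rightarrow> bool" where
  "has_koszul_chain R \<mm> \<F> I \<longleftrightarrow>
     (\<exists>(n::nat) J x. J 0 = {\<zero>\<^bsub>R\<^esub>} \<and> J n = I \<and>
        (\<forall>j\<in>{1..n}. x j \<in> \<mm> \<and> J (j - 1) \<subset> J j \<and> J j \<in> \<F> \<and>
           J j = J (j - 1) <+>\<^bsub>R\<^esub> PIdl\<^bsub>R\<^esub> (x j) \<and>
           ideal_colon R (J (j - 1)) (x j) \<in> \<F>))"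

lemma has_koszul_chain_zero: "has_koszul_chain R \<mm> \<F> {\<zero>\<^bsub>R\<^esub>}"
  unfolding has_koszul_chain_def by (intro exI[of _ 0] exI[of _ "\<lambda>_. {\<zero>\<^bsub>R\<^esub>}"]) auto

text \<open>Chains are built from the bottom: in each application the new ideal is the sum of one that
  already has a chain and a principal ideal.\<close>

lemma has_koszul_chain_step:
  assumes "has_koszul_chain R \<mm> \<F> I" "I' = I <+>\<^bsub>R\<^esub> PIdl\<^bsub>R\<^esub> x" "I \<subset> I'" "I' \<in> \<F>" "x \<in> \<mm>"
    "ideal_colon R I x \<in> \<F>"
  shows "has_koszul_chain R \<mm> \<F> I'"
proof -
  obtain n :: nat and J u where J: "J 0 = {\<zero>\<^bsub>R\<^esub>}" "J n = I" and
    step: "\<forall>j\<in>{1..n}. u j \<in> \<mm> \<and> J (j - 1) \<subset> J j \<and> J j \<in> \<F> \<and>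
           J j = J (j - 1) <+>\<^bsub>R\<^esub> PIdl\<^bsub>R\<^esub> (u j) \<and> ideal_colon R (J (j - 1)) (u j) \<in> \<F>"
    using assms(1) unfolding has_koszul_chain_def by (elim exE conjE) (rule that)
  let ?J = "J(Suc n := I')" and ?u = "u(Suc n := x)"
  have "?u j \<in> \<mm> \<and> ?J (j - 1) \<subset> ?J j \<and> ?J j \<in> \<F> \<and>
           ?J j = ?J (j - 1) <+>\<^bsub>R\<^esub> PIdl\<^bsub>R\<^esub> (?u j) \<and> ideal_colon R (?J (j - 1)) (?u j) \<in> \<F>"
    if "j \<in> {1..Suc n}" for j
  proof (cases "j = Suc n")
    case True thus ?thesis using assms J by simp
  next
    case False
    hence "j \<in> {1..n}" and eqs: "?J j = J j" "?J (j - 1) = J (j - 1)" "?u j = u j"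
      using that by auto
    thus ?thesis using step unfolding eqs by blast
  qed
  hence all: "\<forall>j\<in>{1..Suc n}. ?u j \<in> \<mm> \<and> ?J (j - 1) \<subset> ?J j \<and> ?J j \<in> \<F> \<and>
           ?J j = ?J (j - 1) <+>\<^bsub>R\<^esub> PIdl\<^bsub>R\<^esub> (?u j) \<and> ideal_colon R (?J (j - 1)) (?u j) \<in> \<F>"
    by (rule ballI)
  show ?thesis
    unfolding has_koszul_chain_def
  proof (intro exI conjI)
    show "?J 0 = {\<zero>\<^bsub>R\<^esub>}" "?J (Suc n) = I'" using J by auto
  qed (rule all)
qed

locale conca_ideal_gens = conca_ideal R \<mm> \<qq> for R (structure) and \<mm> \<qq> +
  fixes e :: nat and y :: "nat \<Rightarrow> 'a"
  assumes y_inj: "inj_on y {1..e}"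
    and y_gens: "minimal_generating_set R \<qq> (y ` {1..e})"
begin

definition initial_ideal :: "nat \<Rightarrow> 'a set" where
  "initial_ideal j = Idl (y ` {1..j})"

lemma y_carrier: "i \<in> {1..e} \<Longrightarrow> y i \<in> carrier R"
  using y_gens by (auto simp: minimal_generating_set_def)

lemma y_in_initial_ideal: "i \<in> {1..j} \<Longrightarrow> j \<le> e \<Longrightarrow> y i \<in> initial_ideal j"
  unfolding initial_ideal_def by (rule genideal_self[THEN subsetD]) (use y_carrier in auto)

lemma initial_ideal_mono: "i \<le> j \<Longrightarrow> j \<le> e \<Longrightarrow> initial_ideal i \<subseteq> initial_ideal j"
  unfolding initial_ideal_def by (rule subset_Idl_subset) (use y_carrier in auto)

lemma initial_ideal_ideal: "j \<le> e \<Longrightarrow> ideal (initial_ideal j) R"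
  unfolding initial_ideal_def by (rule genideal_ideal) (use y_carrier in auto)

lemma initial_ideal_0: "initial_ideal 0 = {\<zero>}"
  by (simp add: initial_ideal_def genideal_empty)

lemma initial_ideal_e: "initial_ideal e = \<qq>"
  using y_gens by (simp add: initial_ideal_def minimal_generating_set_def)

lemma y_in_q: "i \<in> {1..e} \<Longrightarrow> y i \<in> \<qq>"
  using y_in_initial_ideal[of i e] initial_ideal_e by simp

lemma initial_ideal_sub_q: "j \<le> e \<Longrightarrow> initial_ideal j \<subseteq> \<qq>"
  unfolding initial_ideal_def by (rule genideal_minimal[OF q_ideal]) (use y_in_q in auto)

lemma initial_ideal_Suc: "Suc j \<le> e \<Longrightarrow> initial_ideal (Suc j) = initial_ideal j <+> PIdl (y (Suc j))"
  using genideal_insert[of "y ` {1..j}" "y (Suc j)"] y_carrier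
  by (simp add: initial_ideal_def atLeastAtMostSuc_conv image_subset_iff)

text \<open>The part of Nakayama's lemma that is needed here, with nilpotency of \<open>\<mm>\<close> in place of the
  general argument: a relation \<open>y k = u + p\<close> with \<open>p \<in> \<qq>\<mm>\<close> gives \<open>\<mm>(y k) \<subseteq> (y i : i \<noteq> k)\<close>
  since \<open>\<mm>p = 0\<close>, hence \<open>p\<close> and then \<open>y k\<close> itself lie in the ideal of the other generators.\<close>

lemma minimal_generator_mod_max:
  assumes k: "k \<in> {1..e}" and u: "u \<in> Idl (y ` ({1..e} - {k}))" and p: "p \<in> \<qq> \<cdot> \<mm>"
  shows "y k \<noteq> u \<oplus> p"
proof
  assume eq: "y k = u \<oplus> p"
  let ?Y = "y ` ({1..e} - {k})"
  have Yc: "?Y \<subseteq> carrier R" using y_carrier by auto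
  interpret K: ideal "Idl ?Y" R by (rule genideal_ideal[OF Yc])
  have uc: "u \<in> carrier R" using u by (rule K.Icarr)
  have pc: "p \<in> carrier R" using p ideal_prod_in_carrier[OF q_ideal max.is_ideal] by blast
  have yk: "c \<otimes> y k \<in> Idl ?Y" if c: "c \<in> \<mm>" for c
  proof -
    have "p \<otimes> c \<in> (\<mm> \<cdot> \<mm>) \<cdot> \<mm>"
      using p c max_square by (auto intro: ideal_prod.prod)
    hence "c \<otimes> p = \<zero>" using max_cube pc c m_comm by auto
    hence "c \<otimes> y k = c \<otimes> u"
      using c uc pc eq by (simp add: r_distr)
    thus ?thesis using K.I_l_closed[OF u] c by auto
  qed
  have "\<qq> \<subseteq> {r \<in> carrier R. \<forall>s\<in>\<mm>. s \<otimes> r \<in> Idl ?Y}"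
  proof -
    have "y ` {1..e} \<subseteq> {r \<in> carrier R. \<forall>s\<in>\<mm>. s \<otimes> r \<in> Idl ?Y}"
    proof (rule image_subsetI)
      fix i assume i: "i \<in> {1..e}"
      show "y i \<in> {r \<in> carrier R. \<forall>s\<in>\<mm>. s \<otimes> r \<in> Idl ?Y}"
      proof (cases "i = k")
        case False
        hence "y i \<in> Idl ?Y" using i genideal_self[OF Yc] by auto
        thus ?thesis using K.I_l_closed K.Icarr by auto
      qed (use yk y_carrier k in auto)
    qed
    from genideal_minimal[OF ideal_multipliers[OF K.is_ideal max.a_subset] this]
    show ?thesis using initial_ideal_e by (auto simp: initial_ideal_def)
  qed
  moreover have "p \<in> \<mm> \<cdot> \<qq>"
    using p ideal_prod_commute[OF q_ideal max.is_ideal] by simp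
  ultimately have "p \<in> Idl ?Y"
    using ideal_prod_subsetI[OF K.is_ideal, of \<mm> \<qq>] by blast
  hence ykY: "y k \<in> Idl ?Y" using u eq K.a_closed by simp
  have "y ` {1..e} \<subseteq> Idl ?Y"
  proof (rule image_subsetI)
    fix i assume "i \<in> {1..e}"
    thus "y i \<in> Idl ?Y" using ykY genideal_self[OF Yc] by (cases "i = k") auto
  qed
  hence "\<qq> \<subseteq> Idl ?Y"
    using genideal_minimal[OF K.is_ideal] initial_ideal_e by (auto simp: initial_ideal_def)
  moreover have "Idl ?Y \<subseteq> \<qq>"
    by (rule genideal_minimal[OF q_ideal]) (use y_in_q in auto)
  ultimately have "Idl ?Y = \<qq>" by blast
  moreover have "?Y \<subset> y ` {1..e}"
    using inj_on_image_mem_iff[OF y_inj k, of "{1..e} - {k}"] k by blast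
  ultimately show False
    using y_gens unfolding minimal_generating_set_def by blast
qed

lemma initial_ideal_sub_others:
  assumes "Suc j \<le> e" shows "initial_ideal j \<subseteq> Idl (y ` ({1..e} - {Suc j}))"
  unfolding initial_ideal_def by (rule subset_Idl_subset) (use assms y_carrier in auto)

text \<open>A unit coefficient would express \<open>y (Suc j)\<close> by the other generators modulo \<open>\<qq>\<mm>\<close>.\<close>

lemma coefficient_in_max:
  assumes j: "Suc j \<le> e" and a: "a \<in> carrier R" and z: "z \<in> initial_ideal j"
    and mem: "z \<oplus> a \<otimes> y (Suc j) \<in> \<qq> \<cdot> \<mm>"
  shows "a \<in> \<mm>"
proof (rule ccontr)
  assume "a \<notin> \<mm>"
  hence u: "a \<in> Units R" using unit_if_notin_max a by blast
  interpret yi: ideal "initial_ideal j" R using initial_ideal_ideal j by simp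
  interpret qm: ideal "\<qq> \<cdot> \<mm>" R by (rule ideal_prod_is_ideal[OF q_ideal max.is_ideal])
  let ?x = "z \<oplus> a \<otimes> y (Suc j)"
  have yc: "y (Suc j) \<in> carrier R" using y_carrier j by simp
  have zc: "z \<in> carrier R" using z by (rule yi.Icarr)
  have "inv a \<otimes> ?x = inv a \<otimes> z \<oplus> y (Suc j)"
    using u yc zc a by (simp add: r_distr m_assoc[symmetric])
  hence "y (Suc j) = \<ominus> (inv a \<otimes> z) \<oplus> inv a \<otimes> ?x"
    using u yc zc a by (simp add: r_neg1)
  moreover have "\<ominus> (inv a \<otimes> z) \<in> Idl (y ` ({1..e} - {Suc j}))"
    using yi.I_l_closed[OF z] yi.a_inv_closed u initial_ideal_sub_others[OF j] by auto
  moreover have "inv a \<otimes> ?x \<in> \<qq> \<cdot> \<mm>"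
    using qm.I_l_closed[OF mem] u by simp
  ultimately show False
    using minimal_generator_mod_max[of "Suc j"] j by auto
qed

text \<open>Condition (F2) for \<open>s = 1\<close> on the ideals \<open>(y 1, \<dots>, y j)\<close>. The generators are peeled off from
  the top: the last coefficient of an element of \<open>\<qq>\<mm>\<close> is in \<open>\<mm>\<close>, and subtracting that term
  leaves an element of \<open>\<qq>\<mm>\<close> in the preceding ideal.\<close>

lemma initial_ideal_inter_max_square: "j \<le> e \<Longrightarrow> initial_ideal j \<inter> (\<qq> \<cdot> \<mm>) \<subseteq> \<mm> \<cdot> initial_ideal j"
proof (induct j)
  case 0
  show ?case using ideal_prod_zero[OF max.is_ideal] by (auto simp: initial_ideal_0)
next
  case (Suc j)
  interpret yS: ideal "initial_ideal (Suc j)" R using initial_ideal_ideal Suc by simp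
  interpret yi: ideal "initial_ideal j" R using initial_ideal_ideal Suc by simp
  interpret qm: ideal "\<qq> \<cdot> \<mm>" R by (rule ideal_prod_is_ideal[OF q_ideal max.is_ideal])
  have ysub: "initial_ideal j \<subseteq> initial_ideal (Suc j)"
    using Suc.prems by (intro initial_ideal_mono) auto
  have ySuc: "y (Suc j) \<in> initial_ideal (Suc j)"
    using y_in_initial_ideal Suc.prems by simp
  show ?case
  proof
    fix x assume x: "x \<in> initial_ideal (Suc j) \<inter> (\<qq> \<cdot> \<mm>)"
    then obtain z a where za: "z \<in> initial_ideal j" "a \<in> carrier R" "x = z \<oplus> a \<otimes> y (Suc j)"
      unfolding initial_ideal_Suc[OF Suc.prems] set_add_def' cgenideal_def by auto
    have a: "a \<in> \<mm>"
      using coefficient_in_max[OF Suc.prems za(2,1)] x za(3) by auto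
    have "y (Suc j) \<otimes> a \<in> \<qq> \<cdot> \<mm>"
      using y_in_q Suc.prems a by (auto intro: ideal_prod.prod)
    hence ay: "a \<otimes> y (Suc j) \<in> \<qq> \<cdot> \<mm>"
      using m_comm za y_carrier Suc.prems by simp
    have "z = x \<ominus> a \<otimes> y (Suc j)"
      using za yi.Icarr y_carrier Suc.prems by (simp add: a_minus_def a_assoc r_neg)
    hence "z \<in> \<qq> \<cdot> \<mm>"
      using x ay qm.a_inv_closed qm.a_closed by (auto simp: a_minus_def)
    hence "z \<in> \<mm> \<cdot> initial_ideal (Suc j)"
      using Suc za(1) ideal_prod_mono[OF order_refl ysub] by auto
    moreover have "a \<otimes> y (Suc j) \<in> \<mm> \<cdot> initial_ideal (Suc j)"
      using a ySuc by (rule ideal_prod.prod)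
    ultimately show "x \<in> \<mm> \<cdot> initial_ideal (Suc j)"
      unfolding za(3) by (rule ideal_prod.sum)
  qed
qed

definition \<F> :: "'a set set" where
  "\<F> = {{\<zero>}} \<union> {Idl (y ` {1..j}) | j. 1 \<le> j \<and> j < e} \<union> {I. ideal I R \<and> I \<subseteq> \<mm> \<and> \<qq> \<subseteq> I}"

lemma F_cases:
  assumes "I \<in> \<F>"
  obtains (y) j where "j \<le> e" "I = initial_ideal j" | (q) "ideal I R" "I \<subseteq> \<mm>" "\<qq> \<subseteq> I"
proof -
  have "I = {\<zero>} \<or> (\<exists>j. j < e \<and> I = initial_ideal j) \<or> (ideal I R \<and> I \<subseteq> \<mm> \<and> \<qq> \<subseteq> I)"
    using assms unfolding \<F>_def initial_ideal_def by auto
  thus thesis using y[of 0] y q initial_ideal_0 by (elim disjE exE conjE) (blast intro: less_imp_le)+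
qed

lemma initial_ideal_in_F:
  assumes "j \<le> e"
  shows "initial_ideal j \<in> \<F>"
proof (cases "j = 0 \<or> j = e")
  case True
  show ?thesis using True initial_ideal_0 initial_ideal_e q_ideal q_sub by (auto simp: \<F>_def)
next
  case False
  hence "1 \<le> j \<and> j < e" using assms by simp
  hence "initial_ideal j \<in> {Idl (y ` {1..j}) | j. 1 \<le> j \<and> j < e}" unfolding initial_ideal_def by blast
  thus ?thesis unfolding \<F>_def by blast
qed

lemma F_ideal: "I \<in> \<F> \<Longrightarrow> ideal I R"
  by (erule F_cases) (auto simp: initial_ideal_ideal)

lemma F_sub_max: "I \<in> \<F> \<Longrightarrow> I \<subseteq> \<mm>"
  using initial_ideal_sub_q q_sub by (elim F_cases) auto

text \<open>For \<open>s \<ge> 2\<close> both sides vanish. For \<open>s = 1\<close> and \<open>\<qq> \<subseteq> I\<close> one has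
  \<open>\<mm>\<^sup>2 = \<qq>\<mm> \<subseteq> I\<mm>\<close>.\<close>

lemma F_inter_max_power:
  assumes I: "I \<in> \<F>" and s: "1 \<le> s"
  shows "I \<inter> ideal_power R \<mm> (s + 1) = ideal_power R \<mm> s \<cdot> I"
proof -
  interpret I: ideal I R by (rule F_ideal[OF I])
  have ms: "ideal (ideal_power R \<mm> s) R" by (rule ideal_power_ideal[OF max.is_ideal])
  have sub: "ideal_power R \<mm> s \<cdot> I \<subseteq> I \<inter> ideal_power R \<mm> (s + 1)"
    using ideal_prod_inter[OF ms I.is_ideal] ideal_prod_mono[OF order_refl F_sub_max[OF I]]
    by auto
  have "I \<inter> ideal_power R \<mm> (s + 1) \<subseteq> ideal_power R \<mm> s \<cdot> I"
  proof (cases "s = 1")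
    case False
    hence "ideal_power R \<mm> (s + 1) = {\<zero>}" using s by (intro max_power_zero) auto
    thus ?thesis
      using additive_subgroup.zero_closed[OF ideal.axioms(1)[OF ideal_prod_is_ideal[OF ms I.is_ideal]]]
      by auto
  next
    case True
    have "I \<inter> (\<qq> \<cdot> \<mm>) \<subseteq> \<mm> \<cdot> I"
      using I
    proof (cases rule: F_cases)
      case (y j) thus ?thesis using initial_ideal_inter_max_square by simp
    next
      case q
      have "\<qq> \<cdot> \<mm> \<subseteq> \<mm> \<cdot> I"
        using ideal_prod_commute[OF q_ideal max.is_ideal] ideal_prod_mono[OF order_refl q(3)]
        by simp
      thus ?thesis by blast
    qed
    thus ?thesis using True max_power_1 max_power_2 by (simp add: numeral_2_eq_2)
  qed
  with sub show ?thesis by blast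
qed

text \<open>The colon ideal \<open>(y 1, \<dots>, y j) : y (Suc j)\<close> contains \<open>\<qq>\<close> because \<open>\<qq>\<^sup>2 = 0\<close>, and it is
  proper because the generators are minimal; so it belongs to the last part of \<open>\<F>\<close>.\<close>

lemma chain_initial_ideal: "j \<le> e \<Longrightarrow> has_koszul_chain R \<mm> \<F> (initial_ideal j)"
proof (induct j)
  case 0 show ?case by (simp add: initial_ideal_0 has_koszul_chain_zero)
next
  case (Suc j)
  interpret yi: ideal "initial_ideal j" R using initial_ideal_ideal Suc by simp
  have yS: "y (Suc j) \<in> \<qq>" and yc: "y (Suc j) \<in> carrier R"
    using y_in_q y_carrier Suc by auto
  have qmc: "\<zero> \<in> \<qq> \<cdot> \<mm>"
    using ideal_prod_is_ideal[OF q_ideal max.is_ideal]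
    by (simp add: additive_subgroup.zero_closed ideal.axioms(1))
  have ynot: "y (Suc j) \<notin> initial_ideal j"
  proof
    assume "y (Suc j) \<in> initial_ideal j"
    hence "y (Suc j) \<in> Idl (y ` ({1..e} - {Suc j}))"
      using initial_ideal_sub_others Suc.prems by blast
    thus False
      using minimal_generator_mod_max[of "Suc j" "y (Suc j)" \<zero>] qmc yc Suc.prems by simp
  qed
  show ?case
  proof (rule has_koszul_chain_step[OF _ initial_ideal_Suc[OF Suc.prems]])
    show "has_koszul_chain R \<mm> \<F> (initial_ideal j)" using Suc by simp
    have "y (Suc j) \<in> initial_ideal (Suc j)" "initial_ideal j \<subseteq> initial_ideal (Suc j)"
      using Suc.prems initial_ideal_mono[of j "Suc j"] by (auto intro!: y_in_initial_ideal)
    thus "initial_ideal j \<subset> initial_ideal (Suc j)" using ynot by blast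
    show "initial_ideal (Suc j) \<in> \<F>" using Suc by (intro initial_ideal_in_F)
    show "y (Suc j) \<in> \<mm>" using yS q_sub by blast
    have "\<qq> \<subseteq> ideal_colon R (initial_ideal j) (y (Suc j))"
      using q_mult_q[OF _ yS] yi.zero_closed by (auto simp: ideal_colon_def)
    moreover have "ideal_colon R (initial_ideal j) (y (Suc j)) \<subseteq> \<mm>"
      using ideal_cancel_unit[OF yi.is_ideal _ _ yc] ynot by (auto simp: ideal_colon_def)
    ultimately show "ideal_colon R (initial_ideal j) (y (Suc j)) \<in> \<F>"
      using ideal_colon_ideal[OF yi.is_ideal yc] by (simp add: \<F>_def)
  qed
qed

text \<open>Above \<open>\<qq>\<close> generators are added one by one. Every colon ideal that occurs is \<open>\<mm>\<close>, since
  \<open>\<mm>\<^sup>2 \<subseteq> \<qq>\<close>; a generator that is already present is skipped in order to keep the chain strict.\<close>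

lemma chain_containing_q:
  assumes "finite S" "S \<subseteq> \<mm>"
  shows "has_koszul_chain R \<mm> \<F> (Idl (\<qq> \<union> S))"
  using assms
proof (induct S)
  case empty
  have "Idl \<qq> = \<qq>" using genideal_minimal[OF q_ideal, of \<qq>] genideal_self[of \<qq>] q.a_subset by auto
  thus ?case using chain_initial_ideal[of e] initial_ideal_e by simp
next
  case (insert x S)
  have c: "\<qq> \<union> S \<subseteq> carrier R" using insert max.a_subset q.a_subset by auto
  have xm: "x \<in> \<mm>" and xc: "x \<in> carrier R" using insert max.a_subset by auto
  let ?I = "Idl (\<qq> \<union> S)"
  interpret I: ideal ?I R by (rule genideal_ideal[OF c])
  have qI: "\<qq> \<subseteq> ?I" using genideal_self[OF c] by auto
  show ?case
  proof (cases "x \<in> ?I")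
    case True
    have "Idl (\<qq> \<union> insert x S) = ?I"
    proof
      show "Idl (\<qq> \<union> insert x S) \<subseteq> ?I"
        using True genideal_self[OF c] by (intro genideal_minimal[OF I.is_ideal]) auto
      show "?I \<subseteq> Idl (\<qq> \<union> insert x S)" using c xc by (intro subset_Idl_subset) auto
    qed
    thus ?thesis using insert by simp
  next
    case False
    have eq: "Idl (\<qq> \<union> insert x S) = ?I <+> PIdl x"
      using genideal_insert[OF c xc] by simp
    have c': "\<qq> \<union> insert x S \<subseteq> carrier R" using c xc by auto
    show ?thesis
    proof (rule has_koszul_chain_step[OF _ eq])
      show "has_koszul_chain R \<mm> \<F> ?I" using insert by simp
      show "?I \<subset> Idl (\<qq> \<union> insert x S)"
        using False genideal_self[OF c'] subset_Idl_subset[OF c', of "\<qq> \<union> S"] by auto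
      have "Idl (\<qq> \<union> insert x S) \<subseteq> \<mm>"
        using insert q_sub by (intro genideal_minimal[OF max.is_ideal]) auto
      thus "Idl (\<qq> \<union> insert x S) \<in> \<F>"
        using genideal_ideal[OF c'] genideal_self[OF c'] by (simp add: \<F>_def)
      show "x \<in> \<mm>" by fact
      have "\<mm> \<subseteq> ideal_colon R ?I x"
        using max_mult_max[OF _ xm] qI by (auto simp: ideal_colon_def)
      moreover have "ideal_colon R ?I x \<subseteq> \<mm>"
        using ideal_cancel_unit[OF I.is_ideal _ _ xc] False by (auto simp: ideal_colon_def)
      ultimately have "ideal_colon R ?I x = \<mm>" by blast
      thus "ideal_colon R ?I x \<in> \<F>" using max.is_ideal q_sub by (simp add: \<F>_def)
    qed
  qed
qed

lemma F_has_chain: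
  assumes "I \<in> \<F>" shows "has_koszul_chain R \<mm> \<F> I"
  using assms
proof (cases rule: F_cases)
  case (y j) thus ?thesis using chain_initial_ideal by simp
next
  case q
  obtain S where S: "S \<subseteq> carrier R" "finite S" "I = Idl S" using finetely_gen[OF q(1)] by blast
  have "Idl (\<qq> \<union> S) = I"
  proof
    show "Idl (\<qq> \<union> S) \<subseteq> I"
      using genideal_self[OF S(1)] q(3) S(3) by (intro genideal_minimal[OF q(1)]) auto
    show "I \<subseteq> Idl (\<qq> \<union> S)"
      unfolding S(3) using S(1) q.a_subset by (intro subset_Idl_subset) auto
  qed
  moreover have "S \<subseteq> \<mm>" using genideal_self[OF S(1)] q(2) S(3) by auto
  ultimately show ?thesis using chain_containing_q[OF S(2)] by simp
qed

lemma koszul_filtration_F: "koszul_filtration R \<mm> \<F>"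
  unfolding koszul_filtration_def has_koszul_chain_def[symmetric]
proof (intro conjI ballI allI impI)
  show "{\<zero>} \<in> \<F>" by (simp add: \<F>_def)
  show "\<mm> \<in> \<F>" using max.is_ideal q_sub by (simp add: \<F>_def)
qed (use F_ideal F_inter_max_power F_has_chain in simp_all)

end

section \<open>Submodules and linear maps\<close>

context module
begin

lemma submoduleI_smult:
  assumes "H \<subseteq> carrier M" "\<zero>\<^bsub>M\<^esub> \<in> H" "\<And>x y. x \<in> H \<Longrightarrow> y \<in> H \<Longrightarrow> x \<oplus>\<^bsub>M\<^esub> y \<in> H"
    and smult: "\<And>a x. a \<in> carrier R \<Longrightarrow> x \<in> H \<Longrightarrow> a \<odot>\<^bsub>M\<^esub> x \<in> H"
  shows "submodule H R M"
proof (rule submoduleI)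
  show "\<ominus>\<^bsub>M\<^esub> x \<in> H" if "x \<in> H" for x
    using smult[of "\<ominus>\<^bsub>R\<^esub> \<one>\<^bsub>R\<^esub>" x] that assms(1) smult_l_minus[of "\<one>\<^bsub>R\<^esub>" x] by auto
qed (use assms in auto)

lemma submodule_zero: "submodule N R M \<Longrightarrow> \<zero>\<^bsub>M\<^esub> \<in> N"
  using subgroup.one_closed[OF submodule.axioms(1)] by fastforce

lemma zero_submodule: "submodule {\<zero>\<^bsub>M\<^esub>} R M"
  by (rule submoduleI_smult) auto

lemma submodule_minus: "submodule N R M \<Longrightarrow> x \<in> N \<Longrightarrow> y \<in> N \<Longrightarrow> x \<ominus>\<^bsub>M\<^esub> y \<in> N"
  unfolding a_minus_def by (rule submoduleE(5)[OF _ _ submoduleE(3)])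

lemma generated_submodule_is_submodule:
  assumes "S \<subseteq> carrier M"
  shows "submodule (generated_submodule R M S) R M"
  unfolding generated_submodule_def
proof (rule submoduleI_smult)
  show "\<Inter>{N. submodule N R M \<and> S \<subseteq> N} \<subseteq> carrier M"
    using carrier_is_submodule assms by blast
qed (auto intro: submodule_zero submoduleE(4,5))

lemma generated_submodule_self: "S \<subseteq> generated_submodule R M S"
  unfolding generated_submodule_def by blast

lemma generated_submodule_minimal:
  "submodule N R M \<Longrightarrow> S \<subseteq> N \<Longrightarrow> generated_submodule R M S \<subseteq> N"
  unfolding generated_submodule_def by blast

lemma generated_submodule_mono: "S \<subseteq> T \<Longrightarrow> generated_submodule R M S \<subseteq> generated_submodule R M T"
  unfolding generated_submodule_def by blast

lemma submodule_finsum: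
  assumes N: "submodule N R M" and "finite A" "f \<in> A \<rightarrow> N"
  shows "finsum M f A \<in> N"
  using assms(2,3)
proof induct
  case empty thus ?case using submodule_zero[OF N] by simp
next
  case (insert a A)
  hence "f \<in> A \<rightarrow> carrier M" "f a \<in> carrier M" using submoduleE(1)[OF N] by auto
  thus ?case using insert submoduleE(5)[OF N] by auto
qed

text \<open>\<open>ideal_times_module\<close> multiplies an ideal with a whole module; the filtrations of a resolution
  below need products with submodules, all taken inside one ambient module.\<close>

definition ideal_smult :: "'a set \<Rightarrow> 'c set \<Rightarrow> 'c set" where
  "ideal_smult I N = generated_submodule R M {a \<odot>\<^bsub>M\<^esub> x | a x. a \<in> I \<and> x \<in> N}"

lemma ideal_times_module_eq: "ideal_times_module R I M = ideal_smult I (carrier M)"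
  by (simp add: ideal_times_module_def ideal_smult_def)

lemma ideal_smult_submodule:
  "I \<subseteq> carrier R \<Longrightarrow> N \<subseteq> carrier M \<Longrightarrow> submodule (ideal_smult I N) R M"
  unfolding ideal_smult_def by (rule generated_submodule_is_submodule) auto

lemma ideal_smultI: "a \<in> I \<Longrightarrow> x \<in> N \<Longrightarrow> a \<odot>\<^bsub>M\<^esub> x \<in> ideal_smult I N"
  unfolding ideal_smult_def by (rule subsetD[OF generated_submodule_self]) blast

lemma ideal_smult_subsetI:
  assumes "submodule K R M" "\<And>a x. a \<in> I \<Longrightarrow> x \<in> N \<Longrightarrow> a \<odot>\<^bsub>M\<^esub> x \<in> K"
  shows "ideal_smult I N \<subseteq> K"
  unfolding ideal_smult_def using assms by (intro generated_submodule_minimal) auto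

lemma ideal_smult_mono: "I \<subseteq> I' \<Longrightarrow> N \<subseteq> N' \<Longrightarrow> ideal_smult I N \<subseteq> ideal_smult I' N'"
  unfolding ideal_smult_def by (rule generated_submodule_mono) blast

lemma ideal_smult_zero: "N \<subseteq> carrier M \<Longrightarrow> ideal_smult {\<zero>\<^bsub>R\<^esub>} N \<subseteq> {\<zero>\<^bsub>M\<^esub>}"
  by (rule ideal_smult_subsetI[OF zero_submodule]) auto

lemma ideal_smult_carrier:
  assumes "submodule N R M"
  shows "ideal_smult (carrier R) N = N"
proof
  show "ideal_smult (carrier R) N \<subseteq> N"
    using submoduleE(4)[OF assms] by (intro ideal_smult_subsetI[OF assms]) auto
  show "N \<subseteq> ideal_smult (carrier R) N"
  proof
    fix x assume x: "x \<in> N"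
    hence "\<one>\<^bsub>R\<^esub> \<odot>\<^bsub>M\<^esub> x = x" using submoduleE(1)[OF assms] by auto
    thus "x \<in> ideal_smult (carrier R) N"
      using ideal_smultI[OF one_closed x] by simp
  qed
qed

text \<open>Inclusions of products of ideals and submodules are bilinear in nature, so it suffices to check
  them on elementary products. The next two lemmas make this precise: for a fixed target \<open>K\<close> the
  scalars, respectively the vectors, that are carried into \<open>K\<close> form an ideal, respectively a
  submodule.\<close>

lemma transporter_ideal:
  assumes "submodule K R M" "x \<in> carrier M"
  shows "ideal {a \<in> carrier R. a \<odot>\<^bsub>M\<^esub> x \<in> K} R"
  using submoduleE[OF assms(1)] submodule_zero[OF assms(1)] assms(2)
  by (intro cring_idealI) (auto simp: smult_l_distr smult_assoc1)

lemma transporter_submodule: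
  assumes "submodule K R M" "I \<subseteq> carrier R"
  shows "submodule {x \<in> carrier M. \<forall>a\<in>I. a \<odot>\<^bsub>M\<^esub> x \<in> K} R M"
proof (rule submoduleI_smult)
  fix b x assume b: "b \<in> carrier R" and x: "x \<in> {x \<in> carrier M. \<forall>a\<in>I. a \<odot>\<^bsub>M\<^esub> x \<in> K}"
  have "a \<odot>\<^bsub>M\<^esub> (b \<odot>\<^bsub>M\<^esub> x) = b \<odot>\<^bsub>M\<^esub> (a \<odot>\<^bsub>M\<^esub> x)" if "a \<in> I" for a
    using that b x assms(2) m_comm[of a b] smult_assoc1[of a b x] smult_assoc1[of b a x] by auto
  thus "b \<odot>\<^bsub>M\<^esub> x \<in> {x \<in> carrier M. \<forall>a\<in>I. a \<odot>\<^bsub>M\<^esub> x \<in> K}"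
    using b x submoduleE(4)[OF assms(1)] by auto
qed (use submoduleE(5)[OF assms(1)] submodule_zero[OF assms(1)] assms(2)
     in \<open>auto simp: smult_r_distr subset_iff\<close>)

lemma ideal_smult_assoc_le:
  assumes "ideal I R" "ideal J R" "N \<subseteq> carrier M" "a \<in> I" "x \<in> ideal_smult J N"
  shows "a \<odot>\<^bsub>M\<^esub> x \<in> ideal_smult (I \<cdot>\<^bsub>R\<^esub> J) N"
proof -
  have IJ: "submodule (ideal_smult (I \<cdot>\<^bsub>R\<^esub> J) N) R M"
    by (rule ideal_smult_submodule[OF ideal_prod_in_carrier[OF assms(1,2)] assms(3)])
  have a: "{a} \<subseteq> carrier R" using ideal.Icarr[OF assms(1,4)] by simp
  have "ideal_smult J N \<subseteq> {x \<in> carrier M. \<forall>b\<in>{a}. b \<odot>\<^bsub>M\<^esub> x \<in> ideal_smult (I \<cdot>\<^bsub>R\<^esub> J) N}"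
  proof (rule ideal_smult_subsetI[OF transporter_submodule[OF IJ a]])
    fix b x assume bx: "b \<in> J" "x \<in> N"
    hence "b \<in> carrier R" "x \<in> carrier M" using ideal.Icarr[OF assms(2)] assms(3) by auto
    moreover have "(a \<otimes>\<^bsub>R\<^esub> b) \<odot>\<^bsub>M\<^esub> x \<in> ideal_smult (I \<cdot>\<^bsub>R\<^esub> J) N"
      using assms(4) bx by (intro ideal_smultI ideal_prod.prod)
    ultimately show "b \<odot>\<^bsub>M\<^esub> x \<in> {x \<in> carrier M. \<forall>b\<in>{a}. b \<odot>\<^bsub>M\<^esub> x \<in> ideal_smult (I \<cdot>\<^bsub>R\<^esub> J) N}"
      using a by (auto simp: smult_assoc1)
  qed
  thus ?thesis using assms(5) by auto
qed

end

locale linear_map = dom: module R M + cod: module R N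
  for R (structure) and M :: "('a, 'b, 'm) module_scheme" and N :: "('a, 'c, 'n) module_scheme" +
  fixes f :: "'b \<Rightarrow> 'c"
  assumes linear: "f \<in> linear_maps R M N"
begin

lemma map_closed [simp, intro]: "x \<in> carrier M \<Longrightarrow> f x \<in> carrier N"
  using linear by (auto simp: linear_maps_def hom_def)

lemma map_add: "x \<in> carrier M \<Longrightarrow> y \<in> carrier M \<Longrightarrow> f (x \<oplus>\<^bsub>M\<^esub> y) = f x \<oplus>\<^bsub>N\<^esub> f y"
  using linear by (auto simp: linear_maps_def hom_def)

lemma map_smult: "a \<in> carrier R \<Longrightarrow> x \<in> carrier M \<Longrightarrow> f (a \<odot>\<^bsub>M\<^esub> x) = a \<odot>\<^bsub>N\<^esub> f x"
  using linear by (auto simp: linear_maps_def)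

lemma map_zero [simp]: "f \<zero>\<^bsub>M\<^esub> = \<zero>\<^bsub>N\<^esub>"
  using map_smult[of \<zero> "\<zero>\<^bsub>M\<^esub>"] by simp

lemma map_neg: "x \<in> carrier M \<Longrightarrow> f (\<ominus>\<^bsub>M\<^esub> x) = \<ominus>\<^bsub>N\<^esub> f x"
  using map_smult[of "\<ominus> \<one>" x] dom.smult_l_minus[of \<one> x] cod.smult_l_minus[of \<one> "f x"] by simp

lemma map_minus: "x \<in> carrier M \<Longrightarrow> y \<in> carrier M \<Longrightarrow> f (x \<ominus>\<^bsub>M\<^esub> y) = f x \<ominus>\<^bsub>N\<^esub> f y"
  by (simp add: a_minus_def map_add map_neg)

lemma mem_kernel: "x \<in> a_kernel M N f \<longleftrightarrow> x \<in> carrier M \<and> f x = \<zero>\<^bsub>N\<^esub>"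
  by (auto simp: a_kernel_def kernel_def)

lemma preimage_submodule:
  assumes "submodule K R N"
  shows "submodule {x \<in> carrier M. f x \<in> K} R M"
  using cod.submoduleE[OF assms] cod.submodule_zero[OF assms]
  by (intro dom.submoduleI_smult) (auto simp: map_add map_smult)

lemma kernel_submodule: "submodule (a_kernel M N f) R M"
proof -
  have "a_kernel M N f = {x \<in> carrier M. f x \<in> {\<zero>\<^bsub>N\<^esub>}}" using mem_kernel by auto
  thus ?thesis using preimage_submodule[OF cod.zero_submodule] by simp
qed

lemma image_submodule:
  assumes K: "submodule K R M"
  shows "submodule (f ` K) R N"
proof (rule cod.submoduleI_smult)
  have Kc: "\<And>x. x \<in> K \<Longrightarrow> x \<in> carrier M" using dom.submoduleE(1)[OF K] by auto
  show "f ` K \<subseteq> carrier N" using Kc by auto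
  show "\<zero>\<^bsub>N\<^esub> \<in> f ` K" using dom.submodule_zero[OF K] map_zero by (metis imageI)
  show "u \<oplus>\<^bsub>N\<^esub> v \<in> f ` K" if uv: "u \<in> f ` K" "v \<in> f ` K" for u v
  proof -
    obtain x y where "x \<in> K" "y \<in> K" "u = f x" "v = f y" using uv by blast
    thus ?thesis using map_add[of x y] Kc dom.submoduleE(5)[OF K, of x y] by (metis imageI)
  qed
  show "a \<odot>\<^bsub>N\<^esub> v \<in> f ` K" if av: "a \<in> carrier R" "v \<in> f ` K" for a v
  proof -
    obtain x where "x \<in> K" "v = f x" using av by blast
    thus ?thesis using map_smult[of a x] Kc dom.submoduleE(4)[OF K av(1), of x] av by (metis imageI)
  qed
qed

end

section \<open>Free modules\<close>

context cring
begin

abbreviation free :: "nat \<Rightarrow> ('a, nat \<Rightarrow> 'a) module" where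
  "free b \<equiv> free_module R b"

lemma free_module_simps:
  "carrier (free b) = {..<b} \<rightarrow>\<^sub>E carrier R"
  "\<zero>\<^bsub>free b\<^esub> = (\<lambda>i\<in>{..<b}. \<zero>)"
  "u \<oplus>\<^bsub>free b\<^esub> v = (\<lambda>i\<in>{..<b}. u i \<oplus> v i)"
  "a \<odot>\<^bsub>free b\<^esub> v = (\<lambda>i\<in>{..<b}. a \<otimes> v i)"
  by (simp_all add: free_module_def)

lemma free_module_eqI:
  assumes "u \<in> carrier (free b)" "v \<in> carrier (free b)" "\<And>i. i < b \<Longrightarrow> u i = v i"
  shows "u = v"
  using assms by (intro PiE_ext[of u "{..<b}" _ v]) (auto simp: free_module_simps)

lemma free_module_module: "module R (free b)"
proof (rule moduleI)
  show "cring R" by (rule is_cring)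
  show "abelian_group (free b)"
  proof (rule abelian_groupI)
    fix u assume u: "u \<in> carrier (free b)"
    show "\<exists>v\<in>carrier (free b). v \<oplus>\<^bsub>free b\<^esub> u = \<zero>\<^bsub>free b\<^esub>"
      using u by (intro bexI[of _ "\<lambda>i\<in>{..<b}. \<ominus> u i"])
        (auto simp: free_module_simps PiE_iff l_neg intro!: restrict_ext)
  qed (auto simp: free_module_simps PiE_iff extensional_def a_ac intro!: ext)
qed (auto simp: free_module_simps PiE_iff extensional_def l_distr r_distr m_assoc intro!: ext)

definition unit_vector :: "nat \<Rightarrow> nat \<Rightarrow> nat \<Rightarrow> 'a" where
  "unit_vector b k = (\<lambda>i\<in>{..<b}. if i = k then \<one> else \<zero>)"

lemma unit_vector_carrier: "unit_vector b k \<in> carrier (free b)"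
  by (auto simp: unit_vector_def free_module_simps)

text \<open>Vectors are written as sums of multiples of unit vectors by removing one entry at a time; \<open>k\<close>
  bounds the support of the vector.\<close>

lemma free_module_entries_in_ideal:
  assumes I: "ideal I R" and v: "v \<in> carrier (free b)" "\<And>i. i < b \<Longrightarrow> v i \<in> I"
  shows "v \<in> ideal_times_module R I (free b)"
proof -
  interpret I: ideal I R by fact
  interpret P: module R "free b" by (rule free_module_module)
  let ?N = "P.ideal_smult I (carrier (free b))"
  have N: "submodule ?N R (free b)" using I.a_subset by (intro P.ideal_smult_submodule) auto
  have "v \<in> ?N" if "k \<le> b" "v \<in> carrier (free b)" "\<And>i. i < b \<Longrightarrow> v i \<in> I"
    "\<And>i. k \<le> i \<Longrightarrow> i < b \<Longrightarrow> v i = \<zero>" for k v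
    using that
  proof (induct k arbitrary: v)
    case 0
    hence "v = \<zero>\<^bsub>free b\<^esub>" by (intro free_module_eqI[of _ b]) (auto simp: free_module_simps)
    thus ?case using P.submodule_zero[OF N] by simp
  next
    case (Suc k)
    let ?w = "v(k := \<zero>)"
    have wc: "?w \<in> carrier (free b)"
      using Suc.prems(1,2) by (auto simp: free_module_simps PiE_iff extensional_def)
    have "?w \<in> ?N"
    proof (rule Suc.hyps[OF _ wc])
      show "?w i = \<zero>" if "k \<le> i" "i < b" for i
        using Suc.prems(4)[of i] that by (cases "i = k") auto
    qed (use Suc.prems in auto)
    moreover have "v k \<odot>\<^bsub>free b\<^esub> unit_vector b k \<in> ?N"
      using Suc.prems unit_vector_carrier by (intro P.ideal_smultI) auto
    moreover have "v = ?w \<oplus>\<^bsub>free b\<^esub> (v k \<odot>\<^bsub>free b\<^esub> unit_vector b k)"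
      using Suc.prems wc unit_vector_carrier
      by (intro free_module_eqI[of _ b])
        (auto simp: free_module_simps unit_vector_def PiE_iff)
    ultimately show ?case using P.submoduleE(5)[OF N] by metis
  qed
  from this[of b v] v show ?thesis by (simp add: P.ideal_times_module_eq)
qed

end

definition finitely_generated_submodule ::
    "('a, 'r) ring_scheme \<Rightarrow> ('a, 'b, 'm) module_scheme \<Rightarrow> 'b set \<Rightarrow> bool" where
  "finitely_generated_submodule R M N \<longleftrightarrow>
     (\<exists>S. finite S \<and> S \<subseteq> carrier M \<and> generated_submodule R M S = N)"

context noeth_local_ring
begin

text \<open>Hilbert's argument, by induction on a bound \<open>k\<close> for the supports of the vectors in \<open>N\<close>. The
  last entries of the vectors in \<open>N\<close> form a finitely generated ideal; lifts \<open>L\<close> of its generators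
  together with generators \<open>S\<close> of the vectors with last entry zero generate \<open>N\<close>.\<close>

lemma submodule_free_finitely_generated:
  assumes "submodule N R (free b)"
  shows "finitely_generated_submodule R (free b) N"
proof -
  interpret P: module R "free b" by (rule free_module_module)
  let ?span = "generated_submodule R (free b)"
  have "finitely_generated_submodule R (free b) N"
    if "k \<le> b" "submodule N R (free b)" "\<And>v i. v \<in> N \<Longrightarrow> k \<le> i \<Longrightarrow> i < b \<Longrightarrow> v i = \<zero>" for k N
    using that
  proof (induct k arbitrary: N)
    case 0
    have "N = {\<zero>\<^bsub>free b\<^esub>}"
    proof -
      have "v = \<zero>\<^bsub>free b\<^esub>" if v: "v \<in> N" for v
      proof (rule free_module_eqI[of _ b])
        show "v \<in> carrier (free b)" using P.submoduleE(1)[OF 0(2)] v by blast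
        show "v i = \<zero>\<^bsub>free b\<^esub> i" if "i < b" for i
          using 0(3)[OF v _ that] that by (simp add: free_module_simps)
      qed simp
      hence "N \<subseteq> {\<zero>\<^bsub>free b\<^esub>}" by blast
      thus ?thesis using P.submodule_zero[OF 0(2)] by blast
    qed
    moreover have "?span {} = {\<zero>\<^bsub>free b\<^esub>}"
      using P.generated_submodule_minimal[OF P.zero_submodule, of "{}"]
        P.submodule_zero[OF P.generated_submodule_is_submodule[of "{}"]] by auto
    ultimately show ?case
      unfolding finitely_generated_submodule_def by (intro exI[of _ "{}"]) auto
  next
    case (Suc k)
    note N = Suc.prems(2) and NE = P.submoduleE[OF Suc.prems(2)]
    have kb: "k < b" using Suc.prems by simp
    have coord_ideal: "ideal ((\<lambda>v. v k) ` K) R" if K: "submodule K R (free b)" for K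
    proof (rule cring_idealI)
      note KE = P.submoduleE[OF K]
      show "(\<lambda>v. v k) ` K \<subseteq> carrier R" using KE(1) kb by (auto simp: free_module_simps)
      show "\<zero> \<in> (\<lambda>v. v k) ` K"
        using kb by (intro image_eqI[OF _ P.submodule_zero[OF K]]) (simp add: free_module_simps)
      show "a \<oplus> c \<in> (\<lambda>v. v k) ` K" if ac: "a \<in> (\<lambda>v. v k) ` K" "c \<in> (\<lambda>v. v k) ` K" for a c
      proof -
        obtain u v where "u \<in> K" "v \<in> K" "a = u k" "c = v k" using ac by blast
        thus ?thesis using KE(5)[of u v] kb
          by (intro image_eqI[of _ _ "u \<oplus>\<^bsub>free b\<^esub> v"]) (auto simp: free_module_simps)
      qed
      show "r \<otimes> a \<in> (\<lambda>v. v k) ` K" if ra: "r \<in> carrier R" "a \<in> (\<lambda>v. v k) ` K" for r a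
      proof -
        obtain u where "u \<in> K" "a = u k" using ra by blast
        thus ?thesis using KE(4)[OF ra(1), of u] kb
          by (intro image_eqI[of _ _ "r \<odot>\<^bsub>free b\<^esub> u"]) (auto simp: free_module_simps)
      qed
    qed
    obtain A where A: "finite A" "A \<subseteq> carrier R" "(\<lambda>v. v k) ` N = Idl A"
      using finetely_gen[OF coord_ideal[OF N]] by blast
    hence "A \<subseteq> (\<lambda>v. v k) ` N" using genideal_self by simp
    then obtain L where L: "L \<subseteq> N" "finite L" "A = (\<lambda>v. v k) ` L"
      using finite_subset_image[OF A(1)] by metis
    have Lc: "L \<subseteq> carrier (free b)" using L NE(1) by blast
    have spanL: "submodule (?span L) R (free b)"
      by (rule P.generated_submodule_is_submodule[OF Lc])
    let ?N' = "{v \<in> N. v k = \<zero>}"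
    have N': "submodule ?N' R (free b)"
      using NE P.submodule_zero[OF N] kb
      by (intro P.submoduleI_smult) (auto simp: free_module_simps)
    have zero: "v i = \<zero>" if "v \<in> ?N'" "k \<le> i" "i < b" for v i
      using that Suc.prems(3)[of v i] by (cases "i = k") auto
    have "finitely_generated_submodule R (free b) ?N'"
    proof (rule Suc.hyps[OF _ N'])
      show "k \<le> b" using kb by simp
    qed (rule zero)
    then obtain S where S: "finite S" "S \<subseteq> carrier (free b)" "?span S = ?N'"
      unfolding finitely_generated_submodule_def by blast
    have LS: "L \<union> S \<subseteq> carrier (free b)" using Lc S by blast
    have span: "submodule (?span (L \<union> S)) R (free b)"
      by (rule P.generated_submodule_is_submodule[OF LS])
    have "N \<subseteq> ?span (L \<union> S)"
    proof
      fix v assume v: "v \<in> N"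
      have "Idl A \<subseteq> (\<lambda>v. v k) ` ?span L"
        unfolding L(3) using P.generated_submodule_self
        by (intro genideal_minimal[OF coord_ideal[OF spanL]]) auto
      hence "v k \<in> (\<lambda>v. v k) ` ?span L" using A(3) v by blast
      then obtain u where u: "u \<in> ?span L" "v k = u k" by blast
      have uN: "u \<in> N" using P.generated_submodule_minimal[OF N L(1)] u by blast
      have uc: "u \<in> carrier (free b)" and vc: "v \<in> carrier (free b)" using uN v NE(1) by auto
      have neg: "(\<ominus>\<^bsub>free b\<^esub> u) k = \<ominus> u k"
      proof -
        have "\<ominus>\<^bsub>free b\<^esub> u = (\<ominus> \<one>) \<odot>\<^bsub>free b\<^esub> u"
          using P.smult_l_minus[of \<one> u] uc by simp
        thus ?thesis using kb uc by (auto simp: free_module_simps PiE_iff l_minus)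
      qed
      have "v \<ominus>\<^bsub>free b\<^esub> u \<in> N" using P.submodule_minus[OF N v uN] .
      moreover have "(v \<ominus>\<^bsub>free b\<^esub> u) k = \<zero>"
        unfolding a_minus_def using kb u uc neg by (auto simp: free_module_simps PiE_iff r_neg)
      ultimately have "v \<ominus>\<^bsub>free b\<^esub> u \<in> ?span S" using S by blast
      hence "v \<ominus>\<^bsub>free b\<^esub> u \<in> ?span (L \<union> S)" "u \<in> ?span (L \<union> S)"
        using P.generated_submodule_mono[of S "L \<union> S"] P.generated_submodule_mono[of L "L \<union> S"] u
        by auto
      moreover have "v = (v \<ominus>\<^bsub>free b\<^esub> u) \<oplus>\<^bsub>free b\<^esub> u"
        using uc vc by (simp add: a_minus_def P.a_assoc P.l_neg)
      ultimately show "v \<in> ?span (L \<union> S)" using P.submoduleE(5)[OF span] by metis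
    qed
    moreover have "?span (L \<union> S) \<subseteq> N"
      using L(1) S(3) P.generated_submodule_self[of S]
      by (intro P.generated_submodule_minimal[OF N]) auto
    ultimately have "?span (L \<union> S) = N" by blast
    thus ?case
      unfolding finitely_generated_submodule_def using L S LS by (intro exI[of _ "L \<union> S"]) auto
  qed
  from this[of b N] assms show ?thesis by auto
qed

end

section \<open>Minimal free resolutions\<close>

context noeth_local_ring
begin

lemma linear_combination_map:
  fixes P :: "('a, 'c, 'm) module_scheme"
  assumes P: "module R P" and g: "\<And>i. i < b \<Longrightarrow> g i \<in> carrier P"
  defines "\<phi> \<equiv> \<lambda>v. \<Oplus>\<^bsub>P\<^esub>i\<in>{..<b}. v i \<odot>\<^bsub>P\<^esub> g i"
  shows "\<phi> \<in> linear_maps R (free b) P"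
    and "\<phi> ` carrier (free b) = generated_submodule R P (g ` {..<b})"
proof -
  interpret P: module R P by (rule P)
  interpret Fr: module R "free b" by (rule free_module_module)
  have entry: "v i \<in> carrier R" if "v \<in> carrier (free b)" "i < b" for v i
    using that by (auto simp: free_module_simps)
  have term_closed: "(\<lambda>i. v i \<odot>\<^bsub>P\<^esub> g i) \<in> {..<b} \<rightarrow> carrier P" if "v \<in> carrier (free b)" for v
    using that entry g by auto
  show lin: "\<phi> \<in> linear_maps R (free b) P"
    unfolding linear_maps_def hom_def
  proof (intro CollectI conjI ballI)
    show "\<phi> \<in> carrier (add_monoid (free b)) \<rightarrow> carrier (add_monoid P)"
      using term_closed unfolding \<phi>_def by (auto intro!: P.finsum_closed)
    fix u v assume uv: "u \<in> carrier (add_monoid (free b))" "v \<in> carrier (add_monoid (free b))"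
    have "\<phi> (u \<oplus>\<^bsub>free b\<^esub> v) = (\<Oplus>\<^bsub>P\<^esub>i\<in>{..<b}. (u i \<odot>\<^bsub>P\<^esub> g i) \<oplus>\<^bsub>P\<^esub> (v i \<odot>\<^bsub>P\<^esub> g i))"
      unfolding \<phi>_def using uv entry g
      by (intro P.finsum_cong') (auto simp: free_module_simps P.smult_l_distr PiE_iff)
    also have "\<dots> = \<phi> u \<oplus>\<^bsub>P\<^esub> \<phi> v"
      unfolding \<phi>_def using uv term_closed by (intro P.finsum_addf) auto
    finally show "\<phi> (u \<otimes>\<^bsub>add_monoid (free b)\<^esub> v) = \<phi> u \<otimes>\<^bsub>add_monoid P\<^esub> \<phi> v" by simp
  next
    fix a v assume av: "a \<in> carrier R" "v \<in> carrier (free b)"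
    have "\<phi> (a \<odot>\<^bsub>free b\<^esub> v) = (\<Oplus>\<^bsub>P\<^esub>i\<in>{..<b}. a \<odot>\<^bsub>P\<^esub> (v i \<odot>\<^bsub>P\<^esub> g i))"
      unfolding \<phi>_def using av entry g
      by (intro P.finsum_cong') (auto simp: free_module_simps P.smult_assoc1 PiE_iff)
    also have "\<dots> = a \<odot>\<^bsub>P\<^esub> \<phi> v"
      unfolding \<phi>_def using av term_closed by (intro P.finsum_smult_ldistr[symmetric]) auto
    finally show "\<phi> (a \<odot>\<^bsub>free b\<^esub> v) = a \<odot>\<^bsub>P\<^esub> \<phi> v" .
  qed
  interpret L: linear_map R "free b" P \<phi> by unfold_locales (rule lin)
  have gc: "g ` {..<b} \<subseteq> carrier P" using g by auto
  note span = P.generated_submodule_is_submodule[OF gc]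
  show "\<phi> ` carrier (free b) = generated_submodule R P (g ` {..<b})"
  proof
    show "\<phi> ` carrier (free b) \<subseteq> generated_submodule R P (g ` {..<b})"
    proof (rule image_subsetI)
      fix v assume v: "v \<in> carrier (free b)"
      have "v i \<odot>\<^bsub>P\<^esub> g i \<in> generated_submodule R P (g ` {..<b})" if "i < b" for i
        using P.generated_submodule_self[of "g ` {..<b}"] that entry[OF v that]
        by (intro P.submoduleE(4)[OF span]) auto
      thus "\<phi> v \<in> generated_submodule R P (g ` {..<b})"
        unfolding \<phi>_def by (intro P.submodule_finsum[OF span]) auto
    qed
    have "g k \<in> \<phi> ` carrier (free b)" if k: "k < b" for k
    proof -
      have "\<phi> (unit_vector b k) = (\<Oplus>\<^bsub>P\<^esub>i\<in>{..<b}. if k = i then g i else \<zero>\<^bsub>P\<^esub>)"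
        unfolding \<phi>_def using g by (intro P.finsum_cong') (auto simp: unit_vector_def)
      also have "\<dots> = g k"
        using g k by (intro P.add.finprod_singleton) auto
      finally show ?thesis using unit_vector_carrier by (metis imageI)
    qed
    thus "generated_submodule R P (g ` {..<b}) \<subseteq> \<phi> ` carrier (free b)"
      by (intro P.generated_submodule_minimal L.image_submodule Fr.carrier_is_submodule) auto
  qed
qed

text \<open>A generating set of least cardinality does it: a relation with a coefficient outside \<open>\<mm>\<close>,
  that is, with a unit coefficient, would make one of the generators superfluous.\<close>

lemma exists_minimal_cover:
  fixes P :: "('a, 'c, 'm) module_scheme"
  assumes P: "module R P" and fg: "finitely_generated_submodule R P N"
  shows "\<exists>b \<phi>. \<phi> \<in> linear_maps R (free b) P \<and> \<phi> ` carrier (free b) = N \<and>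
           (\<forall>v\<in>carrier (free b). \<phi> v = \<zero>\<^bsub>P\<^esub> \<longrightarrow> (\<forall>i<b. v i \<in> \<mm>))"
proof -
  interpret P: module R P by (rule P)
  let ?span = "generated_submodule R P"
  let ?gens = "\<lambda>S. finite S \<and> S \<subseteq> carrier P \<and> ?span S = N"
  obtain S where S: "?gens S" and S_min: "\<And>T. ?gens T \<Longrightarrow> card S \<le> card T"
    using fg unfolding finitely_generated_submodule_def
    by (metis (no_types, lifting) ex_has_least_nat[of ?gens _ card])
  define b where "b = card S"
  obtain g where g: "bij_betw g {..<b} S"
    using S ex_bij_betw_nat_finite[of S] by (auto simp: b_def lessThan_atLeast0)
  hence gS: "g ` {..<b} = S" by (simp add: bij_betw_def)
  have gc: "g i \<in> carrier P" if "i < b" for i using gS S that by auto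
  define \<phi> where "\<phi> = (\<lambda>v. \<Oplus>\<^bsub>P\<^esub>i\<in>{..<b}. v i \<odot>\<^bsub>P\<^esub> g i)"
  have lin: "\<phi> \<in> linear_maps R (free b) P" and img: "\<phi> ` carrier (free b) = N"
    using linear_combination_map[OF P, of b g] gc gS S unfolding \<phi>_def by auto
  have min: "v k \<in> \<mm>" if v: "v \<in> carrier (free b)" and v0: "\<phi> v = \<zero>\<^bsub>P\<^esub>" and k: "k < b" for v k
  proof (rule ccontr)
    assume vk: "v k \<notin> \<mm>"
    have entry: "v i \<in> carrier R" if "i < b" for i
      using that v by (auto simp: free_module_simps)
    have u: "v k \<in> Units R" using unit_if_notin_max[OF entry[OF k] vk] .
    let ?T = "S - {g k}"
    have Tc: "?T \<subseteq> carrier P" using S by auto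
    note span = P.generated_submodule_is_submodule[OF Tc]
    let ?rest = "\<Oplus>\<^bsub>P\<^esub>i\<in>{..<b} - {k}. v i \<odot>\<^bsub>P\<^esub> g i"
    have "v i \<odot>\<^bsub>P\<^esub> g i \<in> ?span ?T" if i: "i \<in> {..<b} - {k}" for i
    proof -
      have "g i \<noteq> g k" using g i k by (auto simp: bij_betw_def inj_on_def)
      hence "g i \<in> ?T" using gS i by auto
      thus ?thesis
        using P.generated_submodule_self[of ?T] entry i by (intro P.submoduleE(4)[OF span]) auto
    qed
    hence rest: "?rest \<in> ?span ?T" by (intro P.submodule_finsum[OF span]) auto
    have restc: "?rest \<in> carrier P" using P.submoduleE(1)[OF span] rest by blast
    have vgk: "v k \<odot>\<^bsub>P\<^esub> g k \<in> carrier P" using entry gc k by auto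
    have "\<phi> v = (\<Oplus>\<^bsub>P\<^esub>i\<in>insert k ({..<b} - {k}). v i \<odot>\<^bsub>P\<^esub> g i)"
      using k by (simp add: \<phi>_def insert_absorb)
    also have "\<dots> = v k \<odot>\<^bsub>P\<^esub> g k \<oplus>\<^bsub>P\<^esub> ?rest"
      using entry gc k by (intro P.finsum_insert) auto
    finally have "v k \<odot>\<^bsub>P\<^esub> g k \<oplus>\<^bsub>P\<^esub> ?rest = \<zero>\<^bsub>P\<^esub>" using v0 by simp
    hence "v k \<odot>\<^bsub>P\<^esub> g k = \<ominus>\<^bsub>P\<^esub> ?rest" using vgk restc P.minus_equality by metis
    hence "v k \<odot>\<^bsub>P\<^esub> g k \<in> ?span ?T" using P.submoduleE(3)[OF span rest] by simp
    hence "inv (v k) \<odot>\<^bsub>P\<^esub> (v k \<odot>\<^bsub>P\<^esub> g k) \<in> ?span ?T"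
      by (rule P.submoduleE(4)[OF span Units_inv_closed[OF u]])
    moreover have "inv (v k) \<odot>\<^bsub>P\<^esub> (v k \<odot>\<^bsub>P\<^esub> g k) = g k"
      using u gc[OF k] by (subst P.smult_assoc1[symmetric]) auto
    ultimately have "S \<subseteq> ?span ?T" using P.generated_submodule_self[of ?T] by auto
    hence "N \<subseteq> ?span ?T" using P.generated_submodule_minimal[OF span] S by blast
    moreover have "?span ?T \<subseteq> N" using P.generated_submodule_mono[of ?T S] S by auto
    ultimately have "?gens ?T" using S by auto
    hence le: "card S \<le> card ?T" by (rule S_min)
    have fin: "finite S" and gk: "g k \<in> S" using S gS k by auto
    show False using le card_Diff1_less[OF fin gk] by linarith
  qed
  show ?thesis
    by (intro exI[of _ b] exI[of _ \<phi>] conjI lin img ballI impI allI) (rule min)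
qed

text \<open>The linearity defect refers to a chosen minimal free resolution, so one has to exist. Each
  differential is a minimal cover of the kernel of its predecessor, and the minimality of a cover
  says that the image of the next differential is in \<open>\<mm>\<close> times the free module.\<close>

lemma exists_minimal_free_resolution:
  fixes M :: "('a, 'c, 'm) module_scheme"
  assumes fg: "finitely_generated_module R M"
  shows "\<exists>F d \<epsilon>. minimal_free_resolution R \<mm> M F d \<epsilon>"
proof -
  have M: "module R M" using fg by (simp add: finitely_generated_module_def)
  interpret M: module R M by (rule M)
  let ?minimal = "\<lambda>b K. \<forall>v\<in>K. \<forall>i<b. v i \<in> \<mm>"
  have cover_kernel:
    "\<exists>c d. d \<in> linear_maps R (free c) (free b) \<and> d ` carrier (free c) = a_kernel (free b) P \<phi> \<and>
       ?minimal c (a_kernel (free c) (free b) d)"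
    if P: "module R P" and \<phi>: "\<phi> \<in> linear_maps R (free b) P"
    for P :: "('a, 'd, 'n) module_scheme" and b \<phi>
  proof -
    interpret P: module R P by (rule P)
    interpret Fr: module R "free b" by (rule free_module_module)
    interpret L: linear_map R "free b" P \<phi> by unfold_locales (rule \<phi>)
    obtain c d where cd: "d \<in> linear_maps R (free c) (free b)"
      "d ` carrier (free c) = a_kernel (free b) P \<phi>"
      "\<And>v i. v \<in> carrier (free c) \<Longrightarrow> d v = \<zero>\<^bsub>free b\<^esub> \<Longrightarrow> i < c \<Longrightarrow> v i \<in> \<mm>"
      using exists_minimal_cover[OF free_module_module
          submodule_free_finitely_generated[OF L.kernel_submodule]] by blast
    interpret Fc: module R "free c" by (rule free_module_module)
    interpret D: linear_map R "free c" "free b" d by unfold_locales (rule cd(1))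
    show ?thesis using cd D.mem_kernel by blast
  qed
  have "finitely_generated_submodule R M (carrier M)"
    using fg by (auto simp: finitely_generated_module_def finitely_generated_submodule_def)
  from exists_minimal_cover[OF M this] obtain b0 \<epsilon> where
    \<epsilon>: "\<epsilon> \<in> linear_maps R (free b0) M" "\<epsilon> ` carrier (free b0) = carrier M" and
    \<epsilon>0: "\<And>v i. v \<in> carrier (free b0) \<Longrightarrow> \<epsilon> v = \<zero>\<^bsub>M\<^esub> \<Longrightarrow> i < b0 \<Longrightarrow> v i \<in> \<mm>" by blast
  interpret F0: module R "free b0" by (rule free_module_module)
  interpret E: linear_map R "free b0" M \<epsilon> by unfold_locales (rule \<epsilon>(1))
  obtain b1 d0 where d0: "d0 \<in> linear_maps R (free b1) (free b0)"
    "d0 ` carrier (free b1) = a_kernel (free b0) M \<epsilon>" "?minimal b1 (a_kernel (free b1) (free b0) d0)"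
    using cover_kernel[OF M \<epsilon>(1)] by blast
  \<comment> \<open>A state is a triple: ranks of target and source of a differential, and the differential.\<close>
  define ok where "ok = (\<lambda>(b, c, d). d \<in> linear_maps R (free c) (free b) \<and>
      ?minimal b (d ` carrier (free c)) \<and> ?minimal c (a_kernel (free c) (free b) d))"
  define follows where "follows = (\<lambda>(b, c, d) (b', c', d'). b' = c \<and>
      d' ` carrier (free c') = a_kernel (free c) (free b) d)"
  have "\<exists>s. s 0 = (b0, b1, d0) \<and> (\<forall>i. ok (s i) \<and> follows (s i) (s (Suc i)))"
  proof -
    have ok0: "ok (b0, b1, d0)"
    proof -
      have "?minimal b0 (a_kernel (free b0) M \<epsilon>)" using E.mem_kernel \<epsilon>0 by blast
      thus ?thesis unfolding ok_def prod.case d0(2) using d0(1,3) by blast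
    qed
    have step: "\<exists>t. ok t \<and> follows s t" if "ok s" for s
    proof -
      obtain b c d where s: "s = (b, c, d)" by (cases s)
      have ds: "d \<in> linear_maps R (free c) (free b)" "?minimal c (a_kernel (free c) (free b) d)"
        using that s by (auto simp: ok_def)
      obtain c' d' where d': "d' \<in> linear_maps R (free c') (free c)"
        "d' ` carrier (free c') = a_kernel (free c) (free b) d"
        "?minimal c' (a_kernel (free c') (free c) d')"
        using cover_kernel[OF free_module_module ds(1)] by blast
      have "ok (c, c', d')"
        unfolding ok_def prod.case d'(2) using d'(1,3) ds(2) by blast
      moreover have "follows s (c, c', d')"
        unfolding follows_def s prod.case using d'(2) by blast
      ultimately show ?thesis by blast
    qed
    let ?s = "rec_nat (b0, b1, d0) (\<lambda>_ s. SOME t. ok t \<and> follows s t)"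
    have "ok (?s i)" for i
      by (induct i) (use ok0 someI_ex[OF step] in auto)
    moreover from this have "follows (?s i) (?s (Suc i))" for i
      using someI_ex[OF step] by auto
    ultimately show ?thesis by (intro exI[of _ ?s]) auto
  qed
  then obtain s where s0: "s 0 = (b0, b1, d0)" and s: "\<And>i. ok (s i)" "\<And>i. follows (s i) (s (Suc i))"
    by blast
  define rk d where "rk i = fst (s i)" and "d i = snd (snd (s i))" for i
  have rk_Suc: "rk (Suc i) = fst (snd (s i))" for i
    using s(2)[of i] by (auto simp: follows_def rk_def split: prod.splits)
  have si: "s i = (rk i, rk (Suc i), d i)" for i
    by (simp add: rk_Suc) (simp add: rk_def d_def)
  have "minimal_free_resolution R \<mm> M (\<lambda>i. free (rk i)) d \<epsilon>"
    unfolding minimal_free_resolution_def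
  proof (intro conjI allI)
    have b: "rk 0 = b0" "rk 1 = b1" "d 0 = d0" using s0 si[of 0] by auto
    show "\<epsilon> \<in> linear_maps R (free (rk 0)) M" "\<epsilon> ` carrier (free (rk 0)) = carrier M"
      "d 0 ` carrier (free (rk 1)) = a_kernel (free (rk 0)) M \<epsilon>"
      using b \<epsilon> d0 by auto
    fix i
    show "d i \<in> linear_maps R (free (rk (Suc i))) (free (rk i))"
      using s(1)[of i] by (simp add: si ok_def)
    show "d (Suc i) ` carrier (free (rk (Suc (Suc i)))) =
        a_kernel (free (rk (Suc i))) (free (rk i)) (d i)"
      using s(2)[of i] unfolding si by (simp add: follows_def)
    have "v \<in> carrier (free (rk i))" if "v \<in> d i ` carrier (free (rk (Suc i)))" for v
      using s(1)[of i] that by (auto simp: si ok_def linear_maps_def hom_def)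
    thus "d i ` carrier (free (rk (Suc i))) \<subseteq> ideal_times_module R \<mm> (free (rk i))"
      using s(1)[of i]
      by (intro subsetI free_module_entries_in_ideal max.is_ideal) (auto simp: si ok_def)
  qed blast
  thus ?thesis by blast
qed

end

section \<open>The square of the maximal ideal in a resolution\<close>

locale conca_resolution = conca_ideal R \<mm> \<qq> + M: module R M
  for R :: "('a, 'r) ring_scheme" (structure) and \<mm> \<qq> and M :: "('a, 'c, 'm) module_scheme" +
  fixes F :: "nat \<Rightarrow> ('a, nat \<Rightarrow> 'a) module"
    and d :: "nat \<Rightarrow> (nat \<Rightarrow> 'a) \<Rightarrow> (nat \<Rightarrow> 'a)"
    and \<epsilon> :: "(nat \<Rightarrow> 'a) \<Rightarrow> 'c"
  assumes resolution: "minimal_free_resolution R \<mm> M F d \<epsilon>"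
    and q_kills: "a \<in> \<qq> \<Longrightarrow> x \<in> carrier M \<Longrightarrow> a \<odot>\<^bsub>M\<^esub> x = \<zero>\<^bsub>M\<^esub>"
begin

lemma
  shows F_free: "\<exists>b. F i = free b"
    and d_linear: "d i \<in> linear_maps R (F (Suc i)) (F i)"
    and \<epsilon>_linear: "\<epsilon> \<in> linear_maps R (F 0) M"
    and image_d_0: "d 0 ` carrier (F (Suc 0)) = a_kernel (F 0) M \<epsilon>"
    and image_d_Suc: "d (Suc i) ` carrier (F (Suc (Suc i))) = a_kernel (F (Suc i)) (F i) (d i)"
    and image_d: "d i ` carrier (F (Suc i)) \<subseteq> ideal_times_module R \<mm> (F i)"
  using resolution unfolding minimal_free_resolution_def by simp_all

lemma F_module: "module R (F i)"
  using F_free[of i] free_module_module by (elim exE) simp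

sublocale F: module R "F i" for i by (rule F_module)
sublocale d: linear_map R "F (Suc i)" "F i" "d i" for i
  by unfold_locales (rule d_linear)
sublocale \<epsilon>: linear_map R "F 0" M \<epsilon>
  by unfold_locales (rule \<epsilon>_linear)

lemma d_kernelE:
  assumes "x \<in> carrier (F (Suc i))" "d i x = \<zero>\<^bsub>F i\<^esub>"
  obtains w where "w \<in> carrier (F (Suc (Suc i)))" "x = d (Suc i) w"
proof -
  have "x \<in> d (Suc i) ` carrier (F (Suc (Suc i)))"
    using assms unfolding image_d_Suc d.mem_kernel by simp
  thus thesis using that by blast
qed

lemma d_d: "w \<in> carrier (F (Suc (Suc i))) \<Longrightarrow> d i (d (Suc i) w) = \<zero>\<^bsub>F i\<^esub>"
  using image_d_Suc[of i] d.mem_kernel by blast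

abbreviation mF :: "nat \<Rightarrow> (nat \<Rightarrow> 'a) set" where
  "mF i \<equiv> F.ideal_smult i \<mm> (carrier (F i))"

abbreviation m2 :: "'a set" where
  "m2 \<equiv> \<mm> \<cdot> \<mm>"

lemma image_d_sub: "x \<in> carrier (F (Suc i)) \<Longrightarrow> d i x \<in> mF i"
  using image_d[of i] unfolding F.ideal_times_module_eq by blast

lemma m2_sub: "m2 \<subseteq> carrier R"
  by (rule ideal_prod_in_carrier) (rule max.is_ideal)+

text \<open>The inclusion \<open>\<mm>\<^sup>2 F\<^sub>i \<subseteq> d(\<mm> F\<^sub>i\<^sub>+\<^sub>1)\<close> is proved by induction along the resolution in a
  refined form: there is a finite increasing filtration \<open>G\<^sub>i\<close> of \<open>F\<^sub>i\<close>, starting at zero and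
  reaching \<open>F\<^sub>i\<close> in step \<open>i + 1\<close>, such that
  \<open>\<qq> G\<^sub>i(j + 1) \<subseteq> d(F\<^sub>i\<^sub>+\<^sub>1) + \<mm> G\<^sub>i(j)\<close>. In degree zero it has the single step \<open>F\<^sub>0\<close>, because
  \<open>\<qq>\<close> kills the module that is resolved; in degree \<open>i + 1\<close> the vectors \<open>w\<close> with
  \<open>\<qq> d(w) \<subseteq> \<mm>\<^sup>2 G\<^sub>i(j)\<close> form the step \<open>j + 1\<close>.\<close>

primrec descent :: "nat \<Rightarrow> nat \<Rightarrow> (nat \<Rightarrow> 'a) set" where
  "descent 0 = (\<lambda>j. if j = 0 then {\<zero>\<^bsub>F 0\<^esub>} else carrier (F 0))"
| "descent (Suc i) = (\<lambda>j. case j of 0 \<Rightarrow> {\<zero>\<^bsub>F (Suc i)\<^esub>}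
     | Suc k \<Rightarrow> {w \<in> carrier (F (Suc i)).
         \<forall>a\<in>\<qq>. a \<odot>\<^bsub>F i\<^esub> d i w \<in> F.ideal_smult i m2 (descent i k)})"

lemma descent_0: "descent i 0 = {\<zero>\<^bsub>F i\<^esub>}"
  by (cases i) simp_all

lemma descent_submodule: "submodule (descent i j) R (F i)"
proof (induct i arbitrary: j)
  case 0
  show ?case using F.zero_submodule F.carrier_is_submodule by simp
next
  case (Suc i)
  show ?case
  proof (cases j)
    case 0 thus ?thesis using F.zero_submodule by simp
  next
    case (Suc k)
    have "submodule (F.ideal_smult i m2 (descent i k)) R (F i)"
      using m2_sub F.submoduleE(1)[OF Suc.hyps] by (rule F.ideal_smult_submodule)
    from d.preimage_submodule[OF F.transporter_submodule[OF this q.a_subset]]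
    have "submodule {w \<in> carrier (F (Suc i)). d i w \<in> {x \<in> carrier (F i).
      \<forall>a\<in>\<qq>. a \<odot>\<^bsub>F i\<^esub> x \<in> F.ideal_smult i m2 (descent i k)}} R (F (Suc i))" .
    moreover have "{w \<in> carrier (F (Suc i)). d i w \<in> {x \<in> carrier (F i).
      \<forall>a\<in>\<qq>. a \<odot>\<^bsub>F i\<^esub> x \<in> F.ideal_smult i m2 (descent i k)}} = descent (Suc i) j"
      using Suc by auto
    ultimately show ?thesis by simp
  qed
qed

lemma descent_carrier: "descent i j \<subseteq> carrier (F i)"
  by (rule F.submoduleE(1)[OF descent_submodule])

lemma descent_mono: "descent i j \<subseteq> descent i (Suc j)"
proof (induct i arbitrary: j)
  case 0 show ?case by simp
next
  case (Suc i)
  show ?case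
  proof (cases j)
    case 0
    thus ?thesis
      using F.submodule_zero[OF descent_submodule, of "Suc i" "Suc 0"]
        descent_0[of "Suc i"] by auto
  next
    case (Suc k)
    show ?thesis
      unfolding Suc using F.ideal_smult_mono[OF order_refl Suc.hyps[of k], of i m2] by auto
  qed
qed

lemma q_smult_m: "a \<in> \<qq> \<Longrightarrow> N \<subseteq> carrier (F i) \<Longrightarrow> x \<in> F.ideal_smult i \<mm> N \<Longrightarrow>
    a \<odot>\<^bsub>F i\<^esub> x \<in> F.ideal_smult i m2 N"
  using F.ideal_smult_assoc_le[OF max.is_ideal max.is_ideal] q_sub by blast

text \<open>The last step is everything because \<open>d\<close> is minimal: \<open>\<qq> d(w) \<subseteq> \<qq>\<mm> F\<^sub>i = \<mm>\<^sup>2 F\<^sub>i\<close>.\<close>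

lemma descent_top: "descent i (Suc i) = carrier (F i)"
proof (induct i)
  case (Suc i)
  show ?case
    using q_smult_m[OF _ order_refl image_d_sub[of _ i]] by (auto simp: Suc)
qed simp

text \<open>Induction on \<open>j\<close>. As \<open>\<mm>\<^sup>2 = \<qq>\<mm>\<close>, it suffices to treat \<open>c b v\<close> with \<open>b \<in> \<qq>\<close>, \<open>c \<in> \<mm>\<close> and
  \<open>v\<close> in step \<open>j + 1\<close>. Write \<open>b v = d(w) + r\<close> with \<open>r \<in> \<mm> G\<^sub>i(j)\<close>. Then \<open>c b v = d(c w) + c r\<close>,
  where \<open>c r \<in> \<mm>\<^sup>2 G\<^sub>i(j)\<close> is covered by the induction hypothesis, and \<open>w\<close> is in step \<open>j + 1\<close> of
  the next filtration because
  \<open>\<qq>\<^sup>2 = 0\<close> gives \<open>\<qq> d(w) = \<qq> r \<subseteq> \<mm>\<^sup>2 G\<^sub>i(j)\<close>.\<close>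

lemma m2_descent_lifts:
  assumes lift: "\<And>j a v. a \<in> \<qq> \<Longrightarrow> v \<in> descent i (Suc j) \<Longrightarrow>
    \<exists>w\<in>carrier (F (Suc i)). \<exists>r\<in>F.ideal_smult i \<mm> (descent i j).
      a \<odot>\<^bsub>F i\<^esub> v = d i w \<oplus>\<^bsub>F i\<^esub> r"
  shows "F.ideal_smult i m2 (descent i j)
    \<subseteq> d i ` F.ideal_smult (Suc i) \<mm> (descent (Suc i) j)"
proof (induct j)
  have target: "submodule (d i ` F.ideal_smult (Suc i) \<mm> (descent (Suc i) j)) R (F i)" for j
    using max.a_subset descent_carrier
    by (intro d.image_submodule F.ideal_smult_submodule)
  {
    case 0
    show ?case
    proof (rule F.ideal_smult_subsetI[OF target])
      fix a x assume "a \<in> m2" "x \<in> descent i 0"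
      hence "a \<odot>\<^bsub>F i\<^esub> x = \<zero>\<^bsub>F i\<^esub>" using m2_sub by (auto simp: descent_0)
      thus "a \<odot>\<^bsub>F i\<^esub> x \<in> d i ` F.ideal_smult (Suc i) \<mm> (descent (Suc i) 0)"
        using F.submodule_zero[OF target[of 0]] by (simp only:)
    qed
  next
    case (Suc j)
    let ?T = "d i ` F.ideal_smult (Suc i) \<mm> (descent (Suc i) (Suc j))"
    have old: "F.ideal_smult i m2 (descent i j) \<subseteq> ?T"
      using Suc F.ideal_smult_mono[OF order_refl descent_mono, of "Suc i" \<mm> "Suc i" j] by blast
    show ?case
    proof (rule F.ideal_smult_subsetI[OF target])
      fix a v assume a: "a \<in> m2" and v: "v \<in> descent i (Suc j)"
      have vc: "v \<in> carrier (F i)" using v descent_carrier by blast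
      have "\<qq> \<cdot> \<mm> \<subseteq> {a \<in> carrier R. a \<odot>\<^bsub>F i\<^esub> v \<in> ?T}"
      proof (rule ideal_prod_subsetI[OF F.transporter_ideal[OF target vc]])
        fix b c assume b: "b \<in> \<qq>" and c: "c \<in> \<mm>"
        have bc: "b \<in> carrier R" "c \<in> carrier R" using b c by auto
        obtain w r where w: "w \<in> carrier (F (Suc i))"
          and r: "r \<in> F.ideal_smult i \<mm> (descent i j)"
          and bv: "b \<odot>\<^bsub>F i\<^esub> v = d i w \<oplus>\<^bsub>F i\<^esub> r"
          using lift[OF b v] by blast
        have rc: "r \<in> carrier (F i)"
          using r F.submoduleE(1)[OF F.ideal_smult_submodule[OF max.a_subset descent_carrier]]
          by blast
        have "w \<in> descent (Suc i) (Suc j)"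
        proof -
          have "b' \<odot>\<^bsub>F i\<^esub> d i w \<in> F.ideal_smult i m2 (descent i j)" if b': "b' \<in> \<qq>" for b'
          proof -
            have b'c: "b' \<in> carrier R" using b' by auto
            \<comment> \<open>\<open>b' b = 0\<close> because the square of \<open>\<qq>\<close> is zero, so only the error term survives.\<close>
            have "b' \<odot>\<^bsub>F i\<^esub> d i w \<oplus>\<^bsub>F i\<^esub> b' \<odot>\<^bsub>F i\<^esub> r = (b' \<otimes> b) \<odot>\<^bsub>F i\<^esub> v"
              using b'c bc w rc vc by (simp add: F.smult_assoc1 bv F.smult_r_distr)
            also have "\<dots> = \<zero>\<^bsub>F i\<^esub>" using q_mult_q[OF b' b] vc by simp
            finally have "b' \<odot>\<^bsub>F i\<^esub> d i w = \<ominus>\<^bsub>F i\<^esub> (b' \<odot>\<^bsub>F i\<^esub> r)"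
              using b'c w rc by (intro F.minus_equality[symmetric]) auto
            moreover have "b' \<odot>\<^bsub>F i\<^esub> r \<in> F.ideal_smult i m2 (descent i j)"
              by (rule q_smult_m[OF b' descent_carrier r])
            ultimately show ?thesis
              using F.submoduleE(3)[OF F.ideal_smult_submodule[OF m2_sub descent_carrier]]
              by simp
          qed
          thus ?thesis using w by simp
        qed
        hence "c \<odot>\<^bsub>F (Suc i)\<^esub> w \<in> F.ideal_smult (Suc i) \<mm> (descent (Suc i) (Suc j))"
          by (rule F.ideal_smultI[OF c])
        hence cw: "c \<odot>\<^bsub>F i\<^esub> d i w \<in> ?T"
          using d.map_smult[OF bc(2) w] by (metis imageI)
        have "c \<odot>\<^bsub>F i\<^esub> r \<in> ?T"
          using F.ideal_smult_assoc_le[OF max.is_ideal max.is_ideal descent_carrier c r] old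
          by blast
        with cw have "c \<odot>\<^bsub>F i\<^esub> d i w \<oplus>\<^bsub>F i\<^esub> c \<odot>\<^bsub>F i\<^esub> r \<in> ?T"
          by (rule F.submoduleE(5)[OF target])
        moreover have "(b \<otimes> c) \<odot>\<^bsub>F i\<^esub> v = c \<odot>\<^bsub>F i\<^esub> d i w \<oplus>\<^bsub>F i\<^esub> c \<odot>\<^bsub>F i\<^esub> r"
          using bc w rc vc by (simp add: m_comm[of b c] F.smult_assoc1 bv F.smult_r_distr)
        ultimately show "b \<otimes> c \<in> {a \<in> carrier R. a \<odot>\<^bsub>F i\<^esub> v \<in> ?T}" using bc by simp
      qed
      thus "a \<odot>\<^bsub>F i\<^esub> v \<in> ?T" using a max_square by auto
    qed
  }
qed

text \<open>The defining property of the filtrations passes from degree \<open>i\<close> to degree \<open>i + 1\<close>: if \<open>d(a v)\<close> is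
  in \<open>\<mm>\<^sup>2 G\<^sub>i(j)\<close>, then it equals \<open>d(r)\<close> for some \<open>r \<in> \<mm> G\<^sub>i\<^sub>+\<^sub>1(j)\<close>, and \<open>a v - r\<close> is a
  boundary by exactness.\<close>

lemma q_descent:
  "a \<in> \<qq> \<Longrightarrow> v \<in> descent i (Suc j) \<Longrightarrow>
    \<exists>w\<in>carrier (F (Suc i)). \<exists>r\<in>F.ideal_smult i \<mm> (descent i j).
      a \<odot>\<^bsub>F i\<^esub> v = d i w \<oplus>\<^bsub>F i\<^esub> r"
proof (induct i arbitrary: a v j)
  case 0
  have ac: "a \<in> carrier R" and vc: "v \<in> carrier (F 0)" using 0 by auto
  have "\<epsilon> (a \<odot>\<^bsub>F 0\<^esub> v) = \<zero>\<^bsub>M\<^esub>"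
    using \<epsilon>.map_smult[OF ac vc] q_kills[OF 0(1) \<epsilon>.map_closed[OF vc]] by simp
  hence "a \<odot>\<^bsub>F 0\<^esub> v \<in> d 0 ` carrier (F (Suc 0))"
    unfolding image_d_0 \<epsilon>.mem_kernel using ac vc by simp
  then obtain w where w: "w \<in> carrier (F (Suc 0))" "a \<odot>\<^bsub>F 0\<^esub> v = d 0 w" by blast
  hence "a \<odot>\<^bsub>F 0\<^esub> v = d 0 w \<oplus>\<^bsub>F 0\<^esub> \<zero>\<^bsub>F 0\<^esub>" by simp
  thus ?case
    using w(1) F.submodule_zero[OF F.ideal_smult_submodule[OF max.a_subset descent_carrier]]
    by blast
next
  case (Suc i)
  have ac: "a \<in> carrier R" using Suc.prems(1) by auto
  have vc: "v \<in> carrier (F (Suc i))" using Suc.prems(2) by simp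
  have "d i (a \<odot>\<^bsub>F (Suc i)\<^esub> v) \<in> F.ideal_smult i m2 (descent i j)"
    using Suc.prems d.map_smult[OF ac vc] by simp
  also have "\<dots> \<subseteq> d i ` F.ideal_smult (Suc i) \<mm> (descent (Suc i) j)"
    by (rule m2_descent_lifts[OF Suc.hyps])
  finally obtain r where r: "r \<in> F.ideal_smult (Suc i) \<mm> (descent (Suc i) j)"
    and eq: "d i (a \<odot>\<^bsub>F (Suc i)\<^esub> v) = d i r" by blast
  have rc: "r \<in> carrier (F (Suc i))"
    using r F.submoduleE(1)[OF F.ideal_smult_submodule[OF max.a_subset descent_carrier]]
    by blast
  have "d i (a \<odot>\<^bsub>F (Suc i)\<^esub> v \<ominus>\<^bsub>F (Suc i)\<^esub> r) = \<zero>\<^bsub>F i\<^esub>"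
    using eq rc ac vc by (simp add: d.map_minus) (simp add: a_minus_def F.r_neg)
  then obtain w where w: "w \<in> carrier (F (Suc (Suc i)))"
    "a \<odot>\<^bsub>F (Suc i)\<^esub> v \<ominus>\<^bsub>F (Suc i)\<^esub> r = d (Suc i) w"
    using d_kernelE[of "a \<odot>\<^bsub>F (Suc i)\<^esub> v \<ominus>\<^bsub>F (Suc i)\<^esub> r" i] rc ac vc by auto
  have "a \<odot>\<^bsub>F (Suc i)\<^esub> v = d (Suc i) w \<oplus>\<^bsub>F (Suc i)\<^esub> r"
    using rc ac vc unfolding w(2)[symmetric] by (simp add: a_minus_def F.a_assoc F.l_neg)
  thus ?case using w(1) r by blast
qed

lemma max_square_in_image:
  "F.ideal_smult i m2 (carrier (F i)) \<subseteq> d i ` mF (Suc i)"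
proof -
  have "F.ideal_smult i m2 (carrier (F i))
      \<subseteq> d i ` F.ideal_smult (Suc i) \<mm> (descent (Suc i) (Suc i))"
    using m2_descent_lifts[OF q_descent, of i "Suc i"]
    by (simp only: descent_top)
  also have "\<dots> \<subseteq> d i ` mF (Suc i)"
    by (intro image_mono F.ideal_smult_mono descent_carrier) simp
  finally show ?thesis .
qed

end

section \<open>The linear part\<close>

lemma (in group) trivial_group_Mod_self: "trivial_group (G Mod carrier G)"
proof -
  have n: "carrier G \<lhd> G"
    by (rule normal_invI[OF subgroup_self]) simp
  have "carrier (G Mod carrier G) = {\<one>\<^bsub>G Mod carrier G\<^esub>}"
    using coset_join2[OF _ subgroup_self] one_closed
    by (auto simp: carrier_FactGroup image_iff)
  thus ?thesis
    using normal.factorgroup_is_group[OF n] by (simp add: trivial_group_def)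
qed

context conca_resolution
begin

abbreviation A :: "nat \<Rightarrow> nat \<Rightarrow> (nat \<Rightarrow> 'a) set" where
  "A \<equiv> adic_filtration R \<mm> F"

lemma A_def: "A n i = F.ideal_smult i (ideal_power R \<mm> (n - i)) (carrier (F i))"
  by (simp add: adic_filtration_def F.ideal_times_module_eq)

lemma max_power_carrier: "ideal_power R \<mm> k \<subseteq> carrier R"
  using ideal_power_ideal[OF max.is_ideal, of k] by (simp add: additive_subgroup.a_subset ideal.axioms(1))

lemma A_submodule: "submodule (A n i) R (F i)"
  unfolding A_def by (rule F.ideal_smult_submodule[OF max_power_carrier order_refl])

lemma A_carrier: "x \<in> A n i \<Longrightarrow> x \<in> carrier (F i)"
  using F.submoduleE(1)[OF A_submodule] by blast

lemma A_zero: "\<zero>\<^bsub>F i\<^esub> \<in> A n i"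
  by (rule F.submodule_zero[OF A_submodule])

lemma A_below: "n \<le> i \<Longrightarrow> A n i = carrier (F i)"
  unfolding A_def using F.ideal_smult_carrier[OF F.carrier_is_submodule] by simp

lemma A_1: "A (Suc i) i = mF i"
  unfolding A_def using max_power_1 by (simp add: Suc_diff_le)

lemma A_2: "A (Suc (Suc i)) i = F.ideal_smult i m2 (carrier (F i))"
  unfolding A_def using max_power_2 max_square by (simp add: Suc_diff_le numeral_2_eq_2)

lemma A_above:
  assumes "i + 3 \<le> n" shows "A n i = {\<zero>\<^bsub>F i\<^esub>}"
proof -
  have "ideal_power R \<mm> (n - i) = {\<zero>}" using assms by (intro max_power_zero) simp
  hence "A n i \<subseteq> {\<zero>\<^bsub>F i\<^esub>}" unfolding A_def using F.ideal_smult_zero[OF order_refl] by simp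
  thus ?thesis using A_zero by blast
qed

lemma A_Suc: "A (Suc n) i \<subseteq> A n i"
proof (cases "n < i")
  case True thus ?thesis using A_carrier A_below[of n i] by auto
next
  case False
  have "ideal_power R \<mm> (Suc n - i) \<subseteq> ideal_power R \<mm> (n - i)"
    using False ideal_prod_inter[OF ideal_power_ideal[OF max.is_ideal] max.is_ideal]
    by (auto simp: Suc_diff_le)
  thus ?thesis unfolding A_def by (rule F.ideal_smult_mono) simp
qed

lemma d_A:
  assumes x: "x \<in> A n (Suc i)"
  shows "d i x \<in> A n i"
proof (cases "n \<le> i")
  case True thus ?thesis using A_below[OF True] A_carrier[OF x] by simp
next
  case False
  then obtain k where n: "n = Suc (i + k)" by (metis less_iff_Suc_add not_le)
  have Pi: "ideal (ideal_power R \<mm> k) R" by (rule ideal_power_ideal[OF max.is_ideal])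
  have "A n (Suc i) \<subseteq> {x \<in> carrier (F (Suc i)). d i x \<in> A n i}"
    unfolding A_def[of n "Suc i"]
  proof (rule F.ideal_smult_subsetI[OF d.preimage_submodule[OF A_submodule]])
    fix a w assume a: "a \<in> ideal_power R \<mm> (n - Suc i)" and w: "w \<in> carrier (F (Suc i))"
    have ac: "a \<in> carrier R" using a max_power_carrier by blast
    have "a \<odot>\<^bsub>F i\<^esub> d i w \<in> F.ideal_smult i (ideal_power R \<mm> k \<cdot> \<mm>) (carrier (F i))"
      using a n by (intro F.ideal_smult_assoc_le[OF Pi max.is_ideal order_refl _ image_d_sub[OF w]]) simp
    hence "a \<odot>\<^bsub>F i\<^esub> d i w \<in> A n i" unfolding A_def n by (simp add: Suc_diff_le)
    thus "a \<odot>\<^bsub>F (Suc i)\<^esub> w \<in> {x \<in> carrier (F (Suc i)). d i x \<in> A n i}"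
      using ac w by (simp add: d.map_smult)
  qed
  thus ?thesis using x by blast
qed

text \<open>Exactness of the linear part in positive degree, for representatives. Put \<open>n = i + 1 + s\<close>; only
  \<open>s = 0\<close> and \<open>s = 2\<close> need more than \<open>\<mm>\<^sup>3 = 0\<close> and the exactness of the resolution. For \<open>s = 0\<close>,
  \<open>d(v) \<in> \<mm>\<^sup>2 F\<^sub>i \<subseteq> d(\<mm> F\<^sub>i\<^sub>+\<^sub>1)\<close> shows that \<open>v\<close> is in \<open>\<mm> F\<^sub>i\<^sub>+\<^sub>1\<close> up to a boundary, and boundaries
  are in \<open>\<mm> F\<^sub>i\<^sub>+\<^sub>1\<close> too. For \<open>s = 2\<close>, \<open>v \<in> \<mm>\<^sup>2 F\<^sub>i\<^sub>+\<^sub>1 \<subseteq> d(\<mm> F\<^sub>i\<^sub>+\<^sub>2)\<close>.\<close>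

lemma graded_exact:
  assumes v: "v \<in> A n (Suc i)" and dv: "d i v \<in> A (Suc n) i"
  shows "\<exists>w\<in>A n (Suc (Suc i)). v \<ominus>\<^bsub>F (Suc i)\<^esub> d (Suc i) w \<in> A (Suc n) (Suc i)"
proof -
  have vc: "v \<in> carrier (F (Suc i))" using A_carrier v by blast
  have zero_works: ?thesis if "v \<in> A (Suc n) (Suc i)"
  proof
    show "\<zero>\<^bsub>F (Suc (Suc i))\<^esub> \<in> A n (Suc (Suc i))" by (rule A_zero)
    have neg: "\<ominus>\<^bsub>F (Suc i)\<^esub> \<zero>\<^bsub>F (Suc i)\<^esub> = \<zero>\<^bsub>F (Suc i)\<^esub>"
      by (intro F.minus_equality) auto
    have "v \<ominus>\<^bsub>F (Suc i)\<^esub> d (Suc i) \<zero>\<^bsub>F (Suc (Suc i))\<^esub> = v"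
      unfolding a_minus_def d.map_zero neg using vc by (rule F.r_zero)
    thus "v \<ominus>\<^bsub>F (Suc i)\<^esub> d (Suc i) \<zero>\<^bsub>F (Suc (Suc i))\<^esub> \<in> A (Suc n) (Suc i)"
      using that by simp
  qed
  have preimage_works: ?thesis if w: "w \<in> A n (Suc (Suc i))" and eq: "v = d (Suc i) w" for w
  proof
    show "v \<ominus>\<^bsub>F (Suc i)\<^esub> d (Suc i) w \<in> A (Suc n) (Suc i)"
      using A_zero vc by (simp add: eq[symmetric] a_minus_def F.r_neg)
  qed (rule w)
  \<comment> \<open>For \<open>n \<le> i\<close> the graded piece is trivial by the convention on non-positive powers.\<close>
  consider "n \<le> i" | "n = Suc i" | "n = Suc (Suc i)" | "n = Suc (Suc (Suc i))" | "Suc i + 3 \<le> n"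
    by linarith
  thus ?thesis
  proof cases
    case 1
    thus ?thesis using zero_works vc A_below[of "Suc n" "Suc i"] by simp
  next
    case 2
    have "d i v \<in> d i ` mF (Suc i)" using dv max_square_in_image 2 A_2 by blast
    then obtain u where u: "u \<in> mF (Suc i)" "d i v = d i u" by blast
    have uc: "u \<in> carrier (F (Suc i))" using u(1) A_1[of "Suc i"] A_carrier by metis
    have "d i (v \<ominus>\<^bsub>F (Suc i)\<^esub> u) = \<zero>\<^bsub>F i\<^esub>"
      using u(2) uc vc by (simp add: d.map_minus) (simp add: a_minus_def F.r_neg)
    then obtain w where "w \<in> carrier (F (Suc (Suc i)))" "v \<ominus>\<^bsub>F (Suc i)\<^esub> u = d (Suc i) w"
      using d_kernelE[of "v \<ominus>\<^bsub>F (Suc i)\<^esub> u" i] uc vc by auto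
    hence "v \<ominus>\<^bsub>F (Suc i)\<^esub> u \<in> A (Suc n) (Suc i)"
      using image_d_sub[of w "Suc i"] A_1[of "Suc i"] 2 by simp
    moreover have "v = (v \<ominus>\<^bsub>F (Suc i)\<^esub> u) \<oplus>\<^bsub>F (Suc i)\<^esub> u"
      using uc vc by (simp add: a_minus_def F.a_assoc F.l_neg)
    ultimately have "v \<in> A (Suc n) (Suc i)"
      using F.submoduleE(5)[OF A_submodule] u(1) A_1[of "Suc i"] 2 by metis
    thus ?thesis by (rule zero_works)
  next
    case 3
    hence "d i v = \<zero>\<^bsub>F i\<^esub>" using dv A_above[of i "Suc n"] by simp
    then obtain w where "w \<in> carrier (F (Suc (Suc i)))" "v = d (Suc i) w"
      using d_kernelE vc by blast
    thus ?thesis using preimage_works A_below[of n "Suc (Suc i)"] 3 by simp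
  next
    case 4
    hence "v \<in> d (Suc i) ` mF (Suc (Suc i))" using v max_square_in_image A_2 by blast
    then obtain w where "w \<in> mF (Suc (Suc i))" "v = d (Suc i) w" by blast
    thus ?thesis using preimage_works A_1[of "Suc (Suc i)"] 4 by simp
  next
    case 5
    hence "v = \<zero>\<^bsub>F (Suc i)\<^esub>" using v A_above[of "Suc i" n] by simp
    thus ?thesis using zero_works A_zero by simp
  qed
qed

abbreviation cls :: "nat \<Rightarrow> nat \<Rightarrow> (nat \<Rightarrow> 'a) \<Rightarrow> (nat \<Rightarrow> 'a) set" where
  "cls n i v \<equiv> A (Suc n) i +>\<^bsub>F i\<^esub> v"

abbreviation gr :: "nat \<Rightarrow> nat \<Rightarrow> (nat \<Rightarrow> 'a) set monoid" where
  "gr n i \<equiv> graded_piece R \<mm> F n i"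

abbreviation L :: "nat \<Rightarrow> (nat \<Rightarrow> (nat \<Rightarrow> 'a) set) monoid" where
  "L i \<equiv> linear_part R \<mm> F i"

abbreviation D :: "nat \<Rightarrow> (nat \<Rightarrow> (nat \<Rightarrow> 'a) set) \<Rightarrow> (nat \<Rightarrow> (nat \<Rightarrow> 'a) set)" where
  "D i \<equiv> linear_part_diff R \<mm> F d i"

section \<open>Homology of the linear part\<close>

lemma A_subgroup: "subgroup (A n i) (add_monoid (F i))"
  using A_submodule by (rule submodule.axioms(1))

lemma A_abelian_subgroup: "abelian_subgroup (A n i) (F i)"
  by (rule abelian_subgroupI3[OF additive_subgroup.intro[OF A_subgroup] F.abelian_group_axioms])

lemma cls_eqI:
  assumes "x \<in> carrier (F i)" "y \<in> carrier (F i)" "x \<ominus>\<^bsub>F i\<^esub> y \<in> A (Suc n) i"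
  shows "cls n i x = cls n i y"
proof -
  have "x = (x \<ominus>\<^bsub>F i\<^esub> y) \<oplus>\<^bsub>F i\<^esub> y"
    using assms(1,2) by (simp add: a_minus_def F.a_assoc F.l_neg)
  hence "x \<in> cls n i y" using assms(3) by (auto simp: a_r_coset_def')
  thus ?thesis
    using abelian_subgroup.a_repr_independence'[OF A_abelian_subgroup _ assms(2)] by metis
qed

lemma cls_zero: "cls n i \<zero>\<^bsub>F i\<^esub> = A (Suc n) i"
  using F.a_coset_join2[OF _ A_subgroup A_zero] by simp

lemma cls_self: "x \<in> carrier (F i) \<Longrightarrow> x \<in> cls n i x"
  using A_zero by (force simp: a_r_coset_def')

lemma cls_eq_one_iff: "x \<in> carrier (F i) \<Longrightarrow> cls n i x = A (Suc n) i \<longleftrightarrow> x \<in> A (Suc n) i"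
  using cls_self F.a_coset_join2[OF _ A_subgroup] by blast

lemma gr_group: "group (gr n i)"
proof -
  interpret S: comm_group "(add_monoid (F i))\<lparr>carrier := A n i\<rparr>"
    by (intro comm_group.intro subgroup.subgroup_is_group[OF A_subgroup F.a_group]
        comm_monoid.submonoid_is_comm_monoid[OF comm_group.axioms(1)[OF F.a_comm_group]]
        subgroup.subgroup_is_submonoid[OF A_subgroup])
  have "subgroup (A (Suc n) i) ((add_monoid (F i))\<lparr>carrier := A n i\<rparr>)"
    by (rule group.subgroup_incl[OF F.a_group A_subgroup A_subgroup A_Suc])
  from S.abelian_FactGroup[OF this] show ?thesis
    unfolding graded_piece_def by (rule comm_group.axioms(2))
qed

lemma gr_carrier: "carrier (gr n i) = cls n i ` A n i"
  by (simp add: graded_piece_def carrier_FactGroup a_r_coset_def r_coset_def)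

lemma gr_one: "one (gr n i) = A (Suc n) i"
  by (simp add: graded_piece_def)

lemma gr_mult:
  assumes "x \<in> A n i" "y \<in> A n i"
  shows "cls n i x \<otimes>\<^bsub>gr n i\<^esub> cls n i y = cls n i (x \<oplus>\<^bsub>F i\<^esub> y)"
  using abelian_subgroup.a_rcos_sum[OF A_abelian_subgroup, of x i y "Suc n"] A_carrier assms
  by (simp add: graded_piece_def set_add_def set_mult_def)

lemma L_group: "group (L i)"
  unfolding linear_part_def using gr_group by (rule sum_group)

lemma L_carrier:
  "x \<in> carrier (L i) \<longleftrightarrow> (\<forall>n. x n \<in> cls n i ` A n i) \<and> finite {n. x n \<noteq> A (Suc n) i}"
  unfolding linear_part_def by (simp add: carrier_sum_group gr_group gr_carrier gr_one PiE_iff)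

lemma L_one: "one (L i) = (\<lambda>n. A (Suc n) i)"
  by (simp add: linear_part_def gr_one restrict_def)

lemma L_mult: "x \<otimes>\<^bsub>L i\<^esub> y = (\<lambda>n. x n \<otimes>\<^bsub>gr n i\<^esub> y n)"
  by (simp add: linear_part_def restrict_def)

lemma D_cls:
  assumes v: "v \<in> A n (Suc i)" and x: "x n = cls n (Suc i) v"
  shows "D i x n = cls n i (d i v)"
proof -
  have vc: "v \<in> carrier (F (Suc i))" using A_carrier v by blast
  have "cls n i (d i u) = cls n i (d i v)" if "u \<in> x n" for u
  proof -
    obtain h where h: "h \<in> A (Suc n) (Suc i)" "u = h \<oplus>\<^bsub>F (Suc i)\<^esub> v"
      using \<open>u \<in> x n\<close> x by (auto simp: a_r_coset_def')
    have hc: "h \<in> carrier (F (Suc i))" using A_carrier h by blast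
    have "d i u \<ominus>\<^bsub>F i\<^esub> d i v = d i h"
      using hc vc h(2) by (simp add: d.map_add a_minus_def F.a_assoc F.r_neg)
    thus ?thesis
      using hc vc h d_A[OF h(1)] by (intro cls_eqI) auto
  qed
  moreover have "v \<in> x n" using cls_self[OF vc] x by simp
  ultimately show ?thesis
    unfolding linear_part_diff_def by blast
qed

lemma D_hom: "D i \<in> hom (L (Suc i)) (L i)"
proof (rule homI)
  fix x assume x: "x \<in> carrier (L (Suc i))"
  have "D i x n \<in> cls n i ` A n i" for n
  proof -
    obtain v where "v \<in> A n (Suc i)" "x n = cls n (Suc i) v" using x by (auto simp: L_carrier)
    thus ?thesis using D_cls d_A by blast
  qed
  moreover have "{n. D i x n \<noteq> A (Suc n) i} \<subseteq> {n. x n \<noteq> A (Suc n) (Suc i)}"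
  proof (rule Collect_mono, rule impI, rule notI)
    fix n assume "D i x n \<noteq> A (Suc n) i" "x n = A (Suc n) (Suc i)"
    thus False using D_cls[OF A_zero, of x n i] by (simp add: cls_zero)
  qed
  ultimately show "D i x \<in> carrier (L i)"
    using x finite_subset by (auto simp: L_carrier)
next
  fix x y assume x: "x \<in> carrier (L (Suc i))" and y: "y \<in> carrier (L (Suc i))"
  show "D i (x \<otimes>\<^bsub>L (Suc i)\<^esub> y) = D i x \<otimes>\<^bsub>L i\<^esub> D i y"
  proof
    fix n
    obtain v where v: "v \<in> A n (Suc i)" "x n = cls n (Suc i) v" using x by (auto simp: L_carrier)
    obtain w where w: "w \<in> A n (Suc i)" "y n = cls n (Suc i) w" using y by (auto simp: L_carrier)
    have "(x \<otimes>\<^bsub>L (Suc i)\<^esub> y) n = cls n (Suc i) (v \<oplus>\<^bsub>F (Suc i)\<^esub> w)"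
      using gr_mult v w by (simp add: L_mult)
    moreover have "v \<oplus>\<^bsub>F (Suc i)\<^esub> w \<in> A n (Suc i)"
      using F.submoduleE(5)[OF A_submodule] v w by blast
    ultimately have "D i (x \<otimes>\<^bsub>L (Suc i)\<^esub> y) n = cls n i (d i (v \<oplus>\<^bsub>F (Suc i)\<^esub> w))"
      by (intro D_cls)
    also have "\<dots> = cls n i (d i v) \<otimes>\<^bsub>gr n i\<^esub> cls n i (d i w)"
      using gr_mult d_A v w A_carrier by (simp add: d.map_add)
    also have "\<dots> = (D i x \<otimes>\<^bsub>L i\<^esub> D i y) n"
      using D_cls[of v n i x] D_cls[of w n i y] v w by (simp add: L_mult)
    finally show "D i (x \<otimes>\<^bsub>L (Suc i)\<^esub> y) n = (D i x \<otimes>\<^bsub>L i\<^esub> D i y) n" .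
  qed
qed

text \<open>Preimages of a cycle are chosen component by component. Where the cycle vanishes the choice is
  zero, so that the preimage has finite support again.\<close>

lemma cycles_eq_boundaries:
  "linear_part_cycles R \<mm> F d (Suc i) = D (Suc i) ` carrier (L (Suc (Suc i)))"
proof
  show "linear_part_cycles R \<mm> F d (Suc i) \<subseteq> D (Suc i) ` carrier (L (Suc (Suc i)))"
  proof
    fix x assume "x \<in> linear_part_cycles R \<mm> F d (Suc i)"
    hence x: "x \<in> carrier (L (Suc i))" and x0: "D i x = (\<lambda>n. A (Suc n) i)"
      by (auto simp: linear_part_cycles_def kernel_def L_one)
    have "\<exists>w\<in>A n (Suc (Suc i)). x n = cls n (Suc i) (d (Suc i) w) \<and>
      (x n = A (Suc n) (Suc i) \<longrightarrow> w = \<zero>\<^bsub>F (Suc (Suc i))\<^esub>)" for n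
    proof (cases "x n = A (Suc n) (Suc i)")
      case True
      thus ?thesis using A_zero by (intro bexI[of _ "\<zero>\<^bsub>F (Suc (Suc i))\<^esub>"]) (auto simp: cls_zero)
    next
      case False
      obtain v where v: "v \<in> A n (Suc i)" "x n = cls n (Suc i) v" using x by (auto simp: L_carrier)
      have "cls n i (d i v) = A (Suc n) i" using D_cls[of v n i x] v x0 by simp
      hence "d i v \<in> A (Suc n) i" using cls_eq_one_iff A_carrier v(1) by simp
      then obtain w where w: "w \<in> A n (Suc (Suc i))"
        "v \<ominus>\<^bsub>F (Suc i)\<^esub> d (Suc i) w \<in> A (Suc n) (Suc i)"
        using graded_exact v(1) by blast
      have "x n = cls n (Suc i) (d (Suc i) w)"
        unfolding v(2) using w A_carrier v(1) by (intro cls_eqI) auto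
      thus ?thesis using False w(1) by blast
    qed
    then obtain w where w: "\<And>n. w n \<in> A n (Suc (Suc i))"
      "\<And>n. x n = cls n (Suc i) (d (Suc i) (w n))"
      "\<And>n. x n = A (Suc n) (Suc i) \<Longrightarrow> w n = \<zero>\<^bsub>F (Suc (Suc i))\<^esub>"
      by metis
    let ?z = "\<lambda>n. cls n (Suc (Suc i)) (w n)"
    have "{n. ?z n \<noteq> A (Suc n) (Suc (Suc i))} \<subseteq> {n. x n \<noteq> A (Suc n) (Suc i)}"
      using w(3) cls_zero by auto
    hence "?z \<in> carrier (L (Suc (Suc i)))"
      using w(1) x finite_subset by (auto simp: L_carrier)
    moreover have "x = D (Suc i) ?z"
      using D_cls[OF w(1), of ?z] w(2) by (intro ext) simp
    ultimately show "x \<in> D (Suc i) ` carrier (L (Suc (Suc i)))" by blast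
  qed
  show "D (Suc i) ` carrier (L (Suc (Suc i))) \<subseteq> linear_part_cycles R \<mm> F d (Suc i)"
  proof (rule image_subsetI)
    fix z assume z: "z \<in> carrier (L (Suc (Suc i)))"
    have "D i (D (Suc i) z) n = A (Suc n) i" for n
    proof -
      obtain w where w: "w \<in> A n (Suc (Suc i))" "z n = cls n (Suc (Suc i)) w"
        using z by (auto simp: L_carrier)
      have "D i (D (Suc i) z) n = cls n i (d i (d (Suc i) w))"
        using D_cls[of w n "Suc i" z] w d_A by (intro D_cls) auto
      thus ?thesis using d_d A_carrier w(1) cls_zero by simp
    qed
    thus "D (Suc i) z \<in> linear_part_cycles R \<mm> F d (Suc i)"
      using D_hom[of "Suc i"] z
      by (auto simp: linear_part_cycles_def kernel_def L_one hom_def)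
  qed
qed

lemma homology_trivial: "trivial_group (linear_part_homology R \<mm> F d (Suc i))"
proof -
  have "subgroup (linear_part_cycles R \<mm> F d (Suc i)) (L (Suc i))"
    using group_hom.subgroup_kernel[OF group_hom.intro[OF L_group L_group], of "Suc i" i "D i"] D_hom
    by (simp add: linear_part_cycles_def group_hom_axioms_def)
  then interpret Z: group "(L (Suc i))\<lparr>carrier := linear_part_cycles R \<mm> F d (Suc i)\<rparr>"
    using L_group by (rule subgroup.subgroup_is_group)
  show ?thesis
    using Z.trivial_group_Mod_self by (simp add: linear_part_homology_def cycles_eq_boundaries)
qed

end

section \<open>Koszul modules and the Koszul filtration\<close>

lemma (in conca_ideal) koszul_module_if_killed:
  fixes M :: "('a, 'c, 'm) module_scheme"
  assumes fg: "finitely_generated_module R M"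
    and q_kills: "\<And>a x. a \<in> \<qq> \<Longrightarrow> x \<in> carrier M \<Longrightarrow> a \<odot>\<^bsub>M\<^esub> x = \<zero>\<^bsub>M\<^esub>"
  shows "koszul_module R \<mm> M"
proof -
  interpret M: module R M using fg by (simp add: finitely_generated_module_def)
  have "linearity_defect R \<mm> M = 0"
  proof (cases "carrier M = {\<zero>\<^bsub>M\<^esub>}")
    case False
    define Fd where "Fd = (SOME (F, d). \<exists>\<epsilon>. minimal_free_resolution R \<mm> M F d \<epsilon>)"
    obtain F d where Fd: "Fd = (F, d)" by (cases Fd)
    have "\<exists>Fd. case Fd of (F, d) \<Rightarrow> \<exists>\<epsilon>. minimal_free_resolution R \<mm> M F d \<epsilon>"
      using exists_minimal_free_resolution[OF fg] by auto
    from someI_ex[OF this] obtain \<epsilon> where res: "minimal_free_resolution R \<mm> M F d \<epsilon>"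
      unfolding Fd_def[symmetric] Fd by auto
    interpret conca_resolution R \<mm> \<qq> M F d \<epsilon>
      by unfold_locales (use res q_kills in auto)
    have "{i. \<not> trivial_group (linear_part_homology R \<mm> F d i)} \<subseteq> {0}"
    proof
      fix i assume "i \<in> {i. \<not> trivial_group (linear_part_homology R \<mm> F d i)}"
      thus "i \<in> {0}" using homology_trivial by (cases i) auto
    qed
    hence "(SUP i\<in>{i. \<not> trivial_group (linear_part_homology R \<mm> F d i)}. enat i) \<le> 0"
      by (intro SUP_least) (auto simp: zero_enat_def)
    thus ?thesis
      using False by (simp add: linearity_defect_def Fd_def[symmetric] Fd)
  qed (simp add: linearity_defect_def)
  thus ?thesis using fg by (simp add: koszul_module_def)
qed

theorem proposition5p12:
  fixes R :: "('a, 'r) ring_scheme"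
    and \<mm> \<qq> :: "'a set"
    and e :: nat
    and y :: "nat \<Rightarrow> 'a"
  assumes "noetherian_local_ring R \<mm>"
    and "ideal \<qq> R"
    and "\<qq> \<subseteq> \<mm>"
    and "ideal_power R \<mm> 2 = \<qq> \<cdot>\<^bsub>R\<^esub> \<mm>"
    and "ideal_power R \<qq> 2 = {\<zero>\<^bsub>R\<^esub>}"
    and "\<forall>i\<in>{1..e}. y i \<in> \<mm>"
    and "inj_on y {1..e}"
    and "minimal_generating_set R \<qq> (y ` {1..e})"
  shows "koszul_filtration R \<mm>
           ({{\<zero>\<^bsub>R\<^esub>}} \<union> {Idl\<^bsub>R\<^esub> (y ` {1..j}) | j. 1 \<le> j \<and> j < e} \<union>
            {I. ideal I R \<and> I \<subseteq> \<mm> \<and> \<qq> \<subseteq> I})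
         \<and> (\<forall>M :: ('a, 'b, 'm) module_scheme.
              finitely_generated_module R M \<and> carrier M \<noteq> {\<zero>\<^bsub>M\<^esub>} \<and>
              ideal_times_module R \<qq> M = {\<zero>\<^bsub>M\<^esub>} \<longrightarrow> koszul_module R \<mm> M)"
proof -
  have loc: "noeth_local_ring R \<mm>"
    using assms(1)
    by (auto simp: noetherian_local_ring_def noeth_local_ring_def noeth_local_ring_axioms_def)
  interpret noeth_local_ring R \<mm> by (rule loc)
  have square: "ideal_power R I 2 = I \<cdot>\<^bsub>R\<^esub> I" if "ideal I R" for I
    using ideal_prod_one[OF that] ideal_prod_commute[OF oneideal that]
    by (simp add: numeral_2_eq_2)
  interpret conca_ideal R \<mm> \<qq>
    by (intro conca_ideal.intro conca_ideal_axioms.intro loc assms(2,3)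
        assms(4)[unfolded square[OF max.is_ideal]] assms(5)[unfolded square[OF assms(2)]])
  interpret conca_ideal_gens R \<mm> \<qq> e y
    by unfold_locales (rule assms(7,8))+
  show ?thesis
  proof (intro conjI allI impI)
    show "koszul_filtration R \<mm>
           ({{\<zero>\<^bsub>R\<^esub>}} \<union> {Idl\<^bsub>R\<^esub> (y ` {1..j}) | j. 1 \<le> j \<and> j < e} \<union>
            {I. ideal I R \<and> I \<subseteq> \<mm> \<and> \<qq> \<subseteq> I})"
      using koszul_filtration_F unfolding \<F>_def .
    fix M :: "('a, 'b, 'm) module_scheme"
    assume M: "finitely_generated_module R M \<and> carrier M \<noteq> {\<zero>\<^bsub>M\<^esub>} \<and>
              ideal_times_module R \<qq> M = {\<zero>\<^bsub>M\<^esub>}"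
    interpret M: module R M using M by (simp add: finitely_generated_module_def)
    show "koszul_module R \<mm> M"
    proof (rule koszul_module_if_killed)
      show "finitely_generated_module R M" using M by blast
      have "M.ideal_smult \<qq> (carrier M) = {\<zero>\<^bsub>M\<^esub>}"
        using M unfolding M.ideal_times_module_eq by blast
      thus "a \<odot>\<^bsub>M\<^esub> x = \<zero>\<^bsub>M\<^esub>" if "a \<in> \<qq>" "x \<in> carrier M" for a x
        using M.ideal_smultI[OF that] by blast
    qed
  qed
qed

end
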